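(* For $n\ge 1$ let $\mathcal{Z}(n)\subset \mathbf{Mould}(n)$ be the linear span of the functions $f_\sigma$, $\sigma\in\mathfrak{S}_n$. Then the subspaces $\mathcal{Z}(n)$ are stable under the compositions $\circ_i$ of the operad $\mathbf{Mould}$, hence form a suboperad of $\mathbf{Mould}$, and this suboperad is isomorphic to the operad Zinbiel, up to mirror image of permutations; that is, the linear maps $\mathrm{Zinb}(n)\to\mathcal{Z}(n)$, $e_w\mapsto f_{\bar w}$ (for $w\in\mathfrak{S}_n$) are bijective and compatible with all the compositions $\circ_i$.
   Context: The operad $\mathbf{Mould}$ (of rational moulds): $\mathbf{Mould}(n)=\mathbb{Q}(u_1,\ldots,u_n)$ is the space of rational functions in $n$ variables. For $f\in\mathbf{Mould}(m)$, $g\in\mathbf{Mould}(n)$ and $1\le i\le m$, the $i$th composition $f\circ_i g\in\mathbf{Mould}(m+n-1)$ is $$(f\circ_i g)(u_1,\ldots,u_{m+n-1})=s\cdot f(u_1,\ldots,u_{i-1},s,u_{i+n},\ldots,u_{m+n-1})\; g(u_i,\ldots,u_{i+n-1}),\qquad s=u_i+u_{i+1}+\cdots+u_{i+n-1}.$$ The unit is $1/u_1\in\mathbf{Mould}(1)$. A suboperad is a family of subspaces containing the unit and stable under all $\circ_i$. For a permutation $\sigma\in\mathfrak{S}_n$, set $$f_\sigma(u_1,\ldots,u_n)=\frac{1}{u_{\sigma(1)}\,(u_{\sigma(1)}+u_{\sigma(2)})\cdots(u_{\sigma(1)}+u_{\sigma(2)}+\cdots+u_{\sigma(n)})}.$$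 The operad Zinbiel (over $\mathbb{Q}$) is the operad governing algebras with one bilinear operation $\prec$ satisfying $(x\prec y)\prec z=x\prec(y\prec z)+x\prec(z\prec y)$. $\mathrm{Zinb}(n)$ is the multilinear part of the free Zinbiel algebra on $x_1,\ldots,x_n$; it has a basis $e_w$ indexed by $w\in\mathfrak{S}_n$, where $e_w=x_{w(1)}\prec(x_{w(2)}\prec(\cdots\prec x_{w(n)})\cdots)$. The composition $a\circ_i b$ (with $a\in\mathrm{Zinb}(m)$, $b\in\mathrm{Zinb}(n)$) is obtained from $a$ by renaming $x_j$ as $x_{j+n-1}$ for $j>i$ and substituting for $x_i$ the element $b(x_i,\ldots,x_{i+n-1})$. For a permutation $w$ written as a word $w(1)\cdots w(n)$, the mirror image is $\bar w=w(n)\cdots w(1)$. *)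

theory Defs
  imports
    Complex_Main
    "HOL-Library.Poly_Mapping"
    "HOL-Computational_Algebra.Fraction_Field"
    "HOL-Combinatorics.Permutations"
begin

section \<open>Rational functions over the rationals in the variables \<open>u\<^sub>j\<close>\<close>

text \<open>
  All spaces \<open>Mould n\<close> live inside the field of rational functions in countably many variables;
  \<open>Mould n\<close> is the subfield of those that only involve \<open>u\<^sub>1, \<dots>, u\<^sub>n\<close>.
\<close>

type_synonym ratpoly = "(nat \<Rightarrow>\<^sub>0 nat) \<Rightarrow>\<^sub>0 rat"
type_synonym ratfun = "ratpoly fract"

definition pvars :: "ratpoly \<Rightarrow> nat set" where
  "pvars p = (\<Union>m\<in>Poly_Mapping.keys p. Poly_Mapping.keys m)"

definition rconst :: "rat \<Rightarrow> ratfun" where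
  "rconst c = Fract (Poly_Mapping.single 0 c) 1"

definition uvar :: "nat \<Rightarrow> ratfun" where
  "uvar j = Fract (Poly_Mapping.single (Poly_Mapping.single j 1) 1) 1"

definition rscale :: "rat \<Rightarrow> ratfun \<Rightarrow> ratfun" where
  "rscale c r = rconst c * r"

global_interpretation rf: vector_space rscale
  defines rf_span = rf.span
    and rf_subspace = rf.subspace
proof
  have add: "rconst (a + b) = rconst a + rconst b" for a b
    by (simp add: rconst_def single_add)
  have mult: "rconst (a * b) = rconst a * rconst b" for a b
    by (simp add: rconst_def mult_single)
  have one: "rconst 1 = 1"
    by (simp add: rconst_def One_fract_def)
  show "rscale a (x + y) = rscale a x + rscale a y" for a x y
    by (simp add: rscale_def algebra_simps)
  show "rscale (a + b) x = rscale a x + rscale b x" for a b x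
    by (simp add: rscale_def add algebra_simps)
  show "rscale a (rscale b x) = rscale (a * b) x" for a b x
    by (simp add: rscale_def mult algebra_simps)
  show "rscale 1 x = x" for x
    by (simp add: rscale_def one)
qed

definition peval :: "(nat \<Rightarrow> ratfun) \<Rightarrow> ratpoly \<Rightarrow> ratfun" where
  "peval \<tau> p = (\<Sum>m\<in>Poly_Mapping.keys p.
     rconst (Poly_Mapping.lookup p m) *
       (\<Prod>j\<in>Poly_Mapping.keys m. \<tau> j ^ Poly_Mapping.lookup m j))"

text \<open>
  Substituting \<open>\<tau> j\<close> for \<open>u\<^sub>j\<close> in \<open>r\<close> is meaningful as soon as some representation of \<open>r\<close> as a
  quotient has a denominator that does not evaluate to zero; the value does not depend on
  which one is taken.
\<close>

definition rsubst :: "(nat \<Rightarrow> ratfun) \<Rightarrow> ratfun \<Rightarrow> ratfun" where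
  "rsubst \<tau> r = (THE z. \<exists>p q. r = Fract p q \<and> peval \<tau> q \<noteq> 0 \<and> z = peval \<tau> p / peval \<tau> q)"


section \<open>The operad of rational moulds\<close>

definition Mould :: "nat \<Rightarrow> ratfun set" where
  "Mould n = {Fract p q | p q. q \<noteq> 0 \<and> pvars p \<subseteq> {1..n} \<and> pvars q \<subseteq> {1..n}}"

text \<open>
  \<open>mould_comp n i f g\<close> is \<open>f \<circ>\<^sub>i g\<close> for \<open>g\<close> of arity \<open>n\<close>; the formula does not involve
  the arity of \<open>f\<close>.
\<close>

definition mould_comp :: "nat \<Rightarrow> nat \<Rightarrow> ratfun \<Rightarrow> ratfun \<Rightarrow> ratfun" where
  "mould_comp n i f g =
     (let s = (\<Sum>k = i..i + n - 1. uvar k) in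
      s * rsubst (\<lambda>j. if j < i then uvar j else if j = i then s else uvar (j + n - 1)) f
        * rsubst (\<lambda>j. uvar (j + i - 1)) g)"

definition mould_unit :: ratfun where
  "mould_unit = 1 / uvar 1"

definition suboperad_Mould :: "(nat \<Rightarrow> ratfun set) \<Rightarrow> bool" where
  "suboperad_Mould P \<longleftrightarrow>
     (\<forall>n\<ge>1. rf_subspace (P n) \<and> P n \<subseteq> Mould n) \<and>
     mould_unit \<in> P 1 \<and>
     (\<forall>m\<ge>1. \<forall>n\<ge>1. \<forall>i\<in>{1..m}. \<forall>f\<in>P m. \<forall>g\<in>P n. mould_comp n i f g \<in> P (m + n - 1))"

definition fperm :: "nat \<Rightarrow> (nat \<Rightarrow> nat) \<Rightarrow> ratfun" where
  "fperm n \<sigma> = 1 / (\<Prod>k = 1..n. \<Sum>j = 1..k. uvar (\<sigma> j))"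

definition Zspan :: "nat \<Rightarrow> ratfun set" where
  "Zspan n = rf_span {fperm n \<sigma> | \<sigma>. \<sigma> permutes {1..n}}"


section \<open>The free Zinbiel algebra and the operad Zinbiel\<close>

text \<open>
  The free Zinbiel algebra on the generators \<open>'a\<close> is the quotient of the formal algebra
  expressions by the congruence generated by the axioms of vector spaces over the rationals,
  bilinearity of the product, and the Zinbiel identity.
\<close>

datatype 'a zterm =
    ZGen 'a
  | ZZero
  | ZAdd "'a zterm" "'a zterm"
  | ZScale rat "'a zterm"
  | ZPrec "'a zterm" "'a zterm"

inductive zeq :: "'a zterm \<Rightarrow> 'a zterm \<Rightarrow> bool" where
  refl: "zeq a a"
| sym: "zeq a b \<Longrightarrow> zeq b a"
| trans: "zeq a b \<Longrightarrow> zeq b c \<Longrightarrow> zeq a c"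
| cong_add: "zeq a a' \<Longrightarrow> zeq b b' \<Longrightarrow> zeq (ZAdd a b) (ZAdd a' b')"
| cong_scale: "zeq a a' \<Longrightarrow> zeq (ZScale r a) (ZScale r a')"
| cong_prec: "zeq a a' \<Longrightarrow> zeq b b' \<Longrightarrow> zeq (ZPrec a b) (ZPrec a' b')"
| add_assoc: "zeq (ZAdd (ZAdd a b) c) (ZAdd a (ZAdd b c))"
| add_comm: "zeq (ZAdd a b) (ZAdd b a)"
| add_zero: "zeq (ZAdd ZZero a) a"
| add_inverse: "zeq (ZAdd (ZScale (- 1) a) a) ZZero"
| scale_add_right: "zeq (ZScale r (ZAdd a b)) (ZAdd (ZScale r a) (ZScale r b))"
| scale_add_left: "zeq (ZScale (r + s) a) (ZAdd (ZScale r a) (ZScale s a))"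
| scale_scale: "zeq (ZScale r (ZScale s a)) (ZScale (r * s) a)"
| scale_one: "zeq (ZScale 1 a) a"
| prec_add_left: "zeq (ZPrec (ZAdd a b) c) (ZAdd (ZPrec a c) (ZPrec b c))"
| prec_add_right: "zeq (ZPrec a (ZAdd b c)) (ZAdd (ZPrec a b) (ZPrec a c))"
| prec_scale_left: "zeq (ZPrec (ZScale r a) b) (ZScale r (ZPrec a b))"
| prec_scale_right: "zeq (ZPrec a (ZScale r b)) (ZScale r (ZPrec a b))"
| zinbiel: "zeq (ZPrec (ZPrec a b) c) (ZAdd (ZPrec a (ZPrec b c)) (ZPrec a (ZPrec c b)))"

quotient_type 'a zinbiel = "'a zterm" / zeq
proof (rule equivpI)
  show "reflp zeq" by (simp add: reflp_def zeq.refl)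
  show "symp zeq" by (auto simp: symp_def intro: zeq.sym)
  show "transp zeq" by (auto simp: transp_def intro: zeq.trans)
qed

lift_definition zgen :: "'a \<Rightarrow> 'a zinbiel" is ZGen .

lift_definition zscale :: "rat \<Rightarrow> 'a zinbiel \<Rightarrow> 'a zinbiel" is ZScale
  by (rule zeq.cong_scale)

lift_definition zprec :: "'a zinbiel \<Rightarrow> 'a zinbiel \<Rightarrow> 'a zinbiel" (infixr \<open>\<prec>\<^sub>Z\<close> 75) is ZPrec
  by (rule zeq.cong_prec)

instantiation zinbiel :: (type) ab_group_add
begin

lift_definition zero_zinbiel :: "'a zinbiel" is ZZero .

lift_definition plus_zinbiel :: "'a zinbiel \<Rightarrow> 'a zinbiel \<Rightarrow> 'a zinbiel" is ZAdd
  by (rule zeq.cong_add)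

definition uminus_zinbiel :: "'a zinbiel \<Rightarrow> 'a zinbiel" where
  "uminus_zinbiel a = zscale (- 1) a"

definition minus_zinbiel :: "'a zinbiel \<Rightarrow> 'a zinbiel \<Rightarrow> 'a zinbiel" where
  "minus_zinbiel a b = a + zscale (- 1) b"

instance
proof
  fix a b c :: "'a zinbiel"
  show "a + b + c = a + (b + c)" by transfer (rule zeq.add_assoc)
  show "a + b = b + a" by transfer (rule zeq.add_comm)
  show "0 + a = a" by transfer (rule zeq.add_zero)
  show "- a + a = 0" unfolding uminus_zinbiel_def by transfer (rule zeq.add_inverse)
  show "a - b = a + - b" by (simp add: uminus_zinbiel_def minus_zinbiel_def)
qed

end

global_interpretation zb: vector_space "zscale :: rat \<Rightarrow> 'a zinbiel \<Rightarrow> 'a zinbiel"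
  defines zb_span = zb.span
proof
  fix r s :: rat and a b :: "'a zinbiel"
  show "zscale r (a + b) = zscale r a + zscale r b" by transfer (rule zeq.scale_add_right)
  show "zscale (r + s) a = zscale r a + zscale s a" by transfer (rule zeq.scale_add_left)
  show "zscale r (zscale s a) = zscale (r * s) a" by transfer (rule zeq.scale_scale)
  show "zscale 1 a = a" by transfer (rule zeq.scale_one)
qed

lemma zprec_bilinear:
  "(a + b) \<prec>\<^sub>Z c = a \<prec>\<^sub>Z c + b \<prec>\<^sub>Z c"
  "a \<prec>\<^sub>Z (b + c) = a \<prec>\<^sub>Z b + a \<prec>\<^sub>Z c"
  "zscale r a \<prec>\<^sub>Z b = zscale r (a \<prec>\<^sub>Z b)"
  "a \<prec>\<^sub>Z zscale r b = zscale r (a \<prec>\<^sub>Z b)"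
  by (transfer, rule zeq.prec_add_left, transfer, rule zeq.prec_add_right,
      transfer, rule zeq.prec_scale_left, transfer, rule zeq.prec_scale_right)

lemma zprec_zinbiel: "(a \<prec>\<^sub>Z b) \<prec>\<^sub>Z c = a \<prec>\<^sub>Z (b \<prec>\<^sub>Z c) + a \<prec>\<^sub>Z (c \<prec>\<^sub>Z b)"
  by transfer (rule zeq.zinbiel)

text \<open>\<open>zsubst \<theta>\<close> is the algebra morphism that sends the generator \<open>x\<close> to \<open>\<theta> x\<close>.\<close>

primrec zterm_eval :: "('a \<Rightarrow> 'b zinbiel) \<Rightarrow> 'a zterm \<Rightarrow> 'b zinbiel" where
  "zterm_eval \<theta> (ZGen x) = \<theta> x"
| "zterm_eval \<theta> ZZero = 0"
| "zterm_eval \<theta> (ZAdd a b) = zterm_eval \<theta> a + zterm_eval \<theta> b"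
| "zterm_eval \<theta> (ZScale r a) = zscale r (zterm_eval \<theta> a)"
| "zterm_eval \<theta> (ZPrec a b) = zterm_eval \<theta> a \<prec>\<^sub>Z zterm_eval \<theta> b"

lemma zterm_eval_zeq: "zeq a b \<Longrightarrow> zterm_eval \<theta> a = zterm_eval \<theta> b"
  by (induction rule: zeq.induct)
    (simp_all add: zprec_bilinear zprec_zinbiel zb.scale_right_distrib zb.scale_left_distrib ac_simps)

lift_definition zsubst :: "('a \<Rightarrow> 'b zinbiel) \<Rightarrow> 'a zinbiel \<Rightarrow> 'b zinbiel" is zterm_eval
  by (rule zterm_eval_zeq)

text \<open>
  \<open>zmono A a\<close>: \<open>a\<close> is a bracketed monomial in which each generator from \<open>A\<close> occurs exactly
  once, and no other generator occurs.
\<close>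

inductive zmono :: "'a set \<Rightarrow> 'a zinbiel \<Rightarrow> bool" where
  gen: "zmono {x} (zgen x)"
| prec: "zmono A a \<Longrightarrow> zmono B b \<Longrightarrow> A \<inter> B = {} \<Longrightarrow> zmono (A \<union> B) (a \<prec>\<^sub>Z b)"

definition Zinb :: "nat \<Rightarrow> nat zinbiel set" where
  "Zinb n = zb_span {a. zmono {1..n} a}"

definition zinb_unit :: "nat zinbiel" where
  "zinb_unit = zgen 1"

text \<open>As for moulds, \<open>n\<close> is the arity of the second argument \<open>b\<close>.\<close>

definition zinb_comp :: "nat \<Rightarrow> nat \<Rightarrow> nat zinbiel \<Rightarrow> nat zinbiel \<Rightarrow> nat zinbiel" where
  "zinb_comp n i a b =
     zsubst (\<lambda>j. if j < i then zgen j
                 else if j = i then zsubst (\<lambda>k. zgen (k + i - 1)) b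
                 else zgen (j + n - 1)) a"

fun zword :: "'a list \<Rightarrow> 'a zinbiel" where
  "zword [] = 0"
| "zword [x] = zgen x"
| "zword (x # y # ys) = zgen x \<prec>\<^sub>Z zword (y # ys)"

definition eperm :: "nat \<Rightarrow> (nat \<Rightarrow> nat) \<Rightarrow> nat zinbiel" where
  "eperm n w = zword (map w [1..<n + 1])"


section \<open>Mirror images and the comparison maps\<close>

definition mirror :: "nat \<Rightarrow> (nat \<Rightarrow> nat) \<Rightarrow> (nat \<Rightarrow> nat)" where
  "mirror n w = (\<lambda>j. if j \<in> {1..n} then w (n + 1 - j) else j)"

text \<open>Only the restriction of \<open>\<phi> n\<close> to \<open>Zinb n\<close> is relevant, and only for \<open>n \<ge> 1\<close>.\<close>

definition mirror_maps :: "(nat \<Rightarrow> nat zinbiel \<Rightarrow> ratfun) \<Rightarrow> bool" where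
  "mirror_maps \<phi> \<longleftrightarrow> (\<forall>n\<ge>1.
     (\<forall>a\<in>Zinb n. \<forall>b\<in>Zinb n. \<phi> n (a + b) = \<phi> n a + \<phi> n b) \<and>
     (\<forall>r. \<forall>a\<in>Zinb n. \<phi> n (zscale r a) = rscale r (\<phi> n a)) \<and>
     (\<forall>w. w permutes {1..n} \<longrightarrow> \<phi> n (eperm n w) = fperm n (mirror n w)))"

definition operad_iso_Zinb :: "(nat \<Rightarrow> ratfun set) \<Rightarrow> (nat \<Rightarrow> nat zinbiel \<Rightarrow> ratfun) \<Rightarrow> bool" where
  "operad_iso_Zinb P \<phi> \<longleftrightarrow>
     (\<forall>n\<ge>1. bij_betw (\<phi> n) (Zinb n) (P n) \<and>
       (\<forall>a\<in>Zinb n. \<forall>b\<in>Zinb n. \<phi> n (a + b) = \<phi> n a + \<phi> n b) \<and>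
       (\<forall>r. \<forall>a\<in>Zinb n. \<phi> n (zscale r a) = rscale r (\<phi> n a))) \<and>
     \<phi> 1 zinb_unit = mould_unit \<and>
     (\<forall>m\<ge>1. \<forall>n\<ge>1. \<forall>i\<in>{1..m}. \<forall>a\<in>Zinb m. \<forall>b\<in>Zinb n.
        \<phi> (m + n - 1) (zinb_comp n i a b) = mould_comp n i (\<phi> m a) (\<phi> n b))"

end

theory Submission
  imports Defs "HOL-Combinatorics.Multiset_Permutations"
begin

text \<open>
  Write \<open>u\<^sub>S\<close> for the sum of the \<open>u\<^sub>j\<close> with \<open>j \<in> S\<close>. A Zinbiel element \<open>a\<close> has
  a coefficient \<open>c\<^sub>a(S)\<close> for each finite set \<open>S\<close> of generators, determined by
  \<open>c\<^sub>x({x}) = 1 / u\<^sub>x\<close> and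
  \<open>c\<^bsub>a \<prec> b\<^esub>(S) = (\<Sum>A \<subseteq> S. u\<^sub>A / u\<^sub>S \<cdot> c\<^sub>a(A) \<cdot> c\<^sub>b(S - A))\<close>.
  The product on the right satisfies the Zinbiel identity because, up to the factor
  \<open>1 / u\<^sub>S\<close>, it is convolution after applying the derivation \<open>u\<^sub>S\<close> to the first factor
  (\<open>conv_zinbiel\<close>); hence the coefficients are well defined on the free Zinbiel algebra. On a word
  \<open>x # w\<close> only the splitting off of \<open>x\<close> contributes, so each letter adds one suffix sum to
  the denominator, and the coefficient of \<open>e\<^sub>w\<close> is the function \<open>f\<close> of the mirror image
  of \<open>w\<close>. The comparison map in arity \<open>n\<close> is therefore \<open>a \<mapsto> c\<^sub>a({1..n})\<close>.

  This description makes compositions transparent. Substituting for the generators elements that live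
  on disjoint blocks replaces the weights \<open>u\<^sub>j\<close> by the sums over the blocks
  (\<open>zcoef_zsubst\<close>), which is the substitution in the formula for \<open>f \<circ>\<^sub>i g\<close>; the factor
  \<open>s\<close> cancels the denominator \<open>1 / s\<close> that the generator \<open>x\<^sub>i\<close> would contribute
  (\<open>mould_of_comp\<close>). To compare coefficients for different weights with substitution
  into rational functions, coefficients are taken for arbitrary weights without vanishing partial sums,
  and \<open>subst_to_zcoef\<close> shows that specialising the weights is the same as substituting.

  Bijectivity is linear algebra on words. They span because a product of two words is a sum of words
  (\<open>zword_prec_zword\<close>), and their images are independent because of their poles
  (\<open>suffix_frac_independent\<close>): among all \<open>f\<^sub>\<sigma>\<close> only those with \<open>\<sigma>(1) = j\<close> have a pole
  along \<open>u\<^sub>j = 0\<close>, and their residues there are the functions of the same kind in the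
  remaining variables. Since the words span, a comparison map is determined by its values on
  them, so every comparison map is the one just described.
\<close>

section \<open>Substitution into rational functions\<close>

definition mono_eval :: "(nat \<Rightarrow> ratfun) \<Rightarrow> (nat \<Rightarrow>\<^sub>0 nat) \<Rightarrow> ratfun" where
  "mono_eval \<tau> m = (\<Prod>j\<in>Poly_Mapping.keys m. \<tau> j ^ Poly_Mapping.lookup m j)"

lemma mono_eval_superset:
  assumes "finite A" "Poly_Mapping.keys m \<subseteq> A"
  shows "mono_eval \<tau> m = (\<Prod>j\<in>A. \<tau> j ^ Poly_Mapping.lookup m j)"
  unfolding mono_eval_def
  by (rule prod.mono_neutral_left) (use assms in \<open>auto simp: in_keys_iff\<close>)

lemma mono_eval_add: "mono_eval \<tau> (m + m') = mono_eval \<tau> m * mono_eval \<tau> m'"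
proof -
  let ?A = "Poly_Mapping.keys m \<union> Poly_Mapping.keys m'"
  have "Poly_Mapping.keys (m + m') \<subseteq> ?A"
    by (rule Poly_Mapping.keys_add)
  then show ?thesis
    by (simp add: mono_eval_superset[of ?A] lookup_add power_add prod.distrib)
qed

lemma rconst_add: "rconst (a + b) = rconst a + rconst b"
  by (simp add: rconst_def single_add)

lemma rconst_mult: "rconst (a * b) = rconst a * rconst b"
  by (simp add: rconst_def mult_single)

lemma rconst_0 [simp]: "rconst 0 = 0"
  by (simp add: rconst_def Zero_fract_def)

lemma rconst_1 [simp]: "rconst 1 = 1"
  by (simp add: rconst_def One_fract_def)

lemma rconst_eq_0_iff [simp]: "rconst a = 0 \<longleftrightarrow> a = 0"
proof -
  have "Poly_Mapping.single 0 a = (0 :: ratpoly) \<longleftrightarrow> a = 0"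
    by (metis lookup_single_eq lookup_zero single_zero)
  then show ?thesis
    by (simp add: rconst_def Zero_fract_def eq_fract)
qed

lemma peval_superset:
  assumes "finite A" "Poly_Mapping.keys p \<subseteq> A"
  shows "peval \<tau> p = (\<Sum>m\<in>A. rconst (Poly_Mapping.lookup p m) * mono_eval \<tau> m)"
  unfolding peval_def mono_eval_def
  by (rule sum.mono_neutral_left) (use assms in \<open>auto simp: in_keys_iff\<close>)

lemma peval_add: "peval \<tau> (p + q) = peval \<tau> p + peval \<tau> q"
proof -
  let ?A = "Poly_Mapping.keys p \<union> Poly_Mapping.keys q"
  have "Poly_Mapping.keys (p + q) \<subseteq> ?A"
    by (rule Poly_Mapping.keys_add)
  then show ?thesis
    by (simp add: peval_superset[of ?A] lookup_add rconst_add sum.distrib algebra_simps)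
qed

lemma peval_0 [simp]: "peval \<tau> 0 = 0"
  by (simp add: peval_def)

lemma peval_single: "peval \<tau> (Poly_Mapping.single m c) = rconst c * mono_eval \<tau> m"
  by (subst peval_superset[of "{m}"]) auto

lemma peval_sum: "peval \<tau> (\<Sum>x\<in>A. f x) = (\<Sum>x\<in>A. peval \<tau> (f x))"
  by (induction A rule: infinite_finite_induct) (simp_all add: peval_add)

lemma poly_mapping_as_sum:
  "(p :: 'a \<Rightarrow>\<^sub>0 'b::comm_monoid_add) =
     (\<Sum>m\<in>Poly_Mapping.keys p. Poly_Mapping.single m (Poly_Mapping.lookup p m))"
  by (rule poly_mapping_eqI)
    (auto simp: lookup_sum lookup_single when_def in_keys_iff)

lemma peval_mult: "peval \<tau> (p * q) = peval \<tau> p * peval \<tau> q"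
proof -
  let ?P = "Poly_Mapping.keys p" and ?Q = "Poly_Mapping.keys q"
  have "p * q = (\<Sum>m\<in>?P. \<Sum>m'\<in>?Q.
      Poly_Mapping.single (m + m') (Poly_Mapping.lookup p m * Poly_Mapping.lookup q m'))"
    by (subst poly_mapping_as_sum[of p], subst poly_mapping_as_sum[of q])
      (simp add: sum_product mult_single)
  then have "peval \<tau> (p * q) = (\<Sum>m\<in>?P. \<Sum>m'\<in>?Q.
      (rconst (Poly_Mapping.lookup p m) * mono_eval \<tau> m) *
      (rconst (Poly_Mapping.lookup q m') * mono_eval \<tau> m'))"
    by (simp add: peval_sum peval_single rconst_mult mono_eval_add mult_ac)
  then show ?thesis
    by (simp add: sum_product peval_superset[OF _ order_refl])
qed

lemma peval_1 [simp]: "peval \<tau> 1 = 1"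
  by (simp add: peval_single mono_eval_def flip: single_one)

text \<open>
  The relation whose values the substitution operator selects. Working with the relation avoids
  regularity side conditions: it is compatible with the field operations as far as denominators
  stay nonzero, and each membership certifies that the substitution is defined.
\<close>

definition subst_to :: "(nat \<Rightarrow> ratfun) \<Rightarrow> ratfun \<Rightarrow> ratfun \<Rightarrow> bool" where
  "subst_to \<tau> r z \<longleftrightarrow> (\<exists>p q. r = Fract p q \<and> peval \<tau> q \<noteq> 0 \<and> z = peval \<tau> p / peval \<tau> q)"

lemma subst_to_unique:
  assumes "subst_to \<tau> r z" "subst_to \<tau> r z'"
  shows "z = z'"
proof -
  obtain p q where 1: "r = Fract p q" "peval \<tau> q \<noteq> 0" "z = peval \<tau> p / peval \<tau> q"
    using assms(1) by (auto simp: subst_to_def)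
  obtain p' q' where 2: "r = Fract p' q'" "peval \<tau> q' \<noteq> 0" "z' = peval \<tau> p' / peval \<tau> q'"
    using assms(2) by (auto simp: subst_to_def)
  have "q \<noteq> 0" "q' \<noteq> 0"
    using 1 2 by auto
  then have "p * q' = p' * q"
    using 1 2 by (simp add: eq_fract)
  then have "peval \<tau> p * peval \<tau> q' = peval \<tau> p' * peval \<tau> q"
    by (metis peval_mult)
  then show ?thesis
    using 1 2 by (simp add: frac_eq_eq)
qed

lemma rsubst_eq: "subst_to \<tau> r z \<Longrightarrow> rsubst \<tau> r = z"
  unfolding rsubst_def subst_to_def[symmetric]
  using subst_to_unique by blast

lemma subst_to_rconst: "subst_to \<tau> (rconst c) (rconst c)"
  unfolding subst_to_def
  by (rule exI[of _ "Poly_Mapping.single 0 c"], rule exI[of _ 1])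
    (simp add: rconst_def peval_single mono_eval_def)

lemma subst_to_0: "subst_to \<tau> 0 0" and subst_to_1: "subst_to \<tau> 1 1"
  using subst_to_rconst[of \<tau> 0] subst_to_rconst[of \<tau> 1] by simp_all

lemma subst_to_uvar: "subst_to \<tau> (uvar j) (\<tau> j)"
  unfolding subst_to_def
  by (rule exI[of _ "Poly_Mapping.single (Poly_Mapping.single j 1) 1"], rule exI[of _ 1])
    (simp add: uvar_def peval_single mono_eval_def)

lemma subst_to_add:
  assumes "subst_to \<tau> r z" "subst_to \<tau> r' z'"
  shows "subst_to \<tau> (r + r') (z + z')"
proof -
  obtain p q where 1: "r = Fract p q" "peval \<tau> q \<noteq> 0" "z = peval \<tau> p / peval \<tau> q"
    using assms(1) by (auto simp: subst_to_def)
  obtain p' q' where 2: "r' = Fract p' q'" "peval \<tau> q' \<noteq> 0" "z' = peval \<tau> p' / peval \<tau> q'"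
    using assms(2) by (auto simp: subst_to_def)
  have "q \<noteq> 0" "q' \<noteq> 0"
    using 1 2 by auto
  then have "r + r' = Fract (p * q' + p' * q) (q * q')"
    using 1 2 by simp
  moreover have "z + z' = peval \<tau> (p * q' + p' * q) / peval \<tau> (q * q')"
    using 1 2 by (simp add: peval_add peval_mult field_simps)
  ultimately show ?thesis
    unfolding subst_to_def using 1 2 by (metis peval_mult mult_eq_0_iff)
qed

lemma subst_to_mult:
  assumes "subst_to \<tau> r z" "subst_to \<tau> r' z'"
  shows "subst_to \<tau> (r * r') (z * z')"
proof -
  obtain p q where 1: "r = Fract p q" "peval \<tau> q \<noteq> 0" "z = peval \<tau> p / peval \<tau> q"
    using assms(1) by (auto simp: subst_to_def)
  obtain p' q' where 2: "r' = Fract p' q'" "peval \<tau> q' \<noteq> 0" "z' = peval \<tau> p' / peval \<tau> q'"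
    using assms(2) by (auto simp: subst_to_def)
  have "r * r' = Fract (p * p') (q * q')"
    using 1 2 by simp
  moreover have "z * z' = peval \<tau> (p * p') / peval \<tau> (q * q')"
    using 1 2 by (simp add: peval_mult)
  ultimately show ?thesis
    unfolding subst_to_def using 1 2 by (metis peval_mult mult_eq_0_iff)
qed

lemma subst_to_divide:
  assumes "subst_to \<tau> r z" "subst_to \<tau> r' z'" "z' \<noteq> 0"
  shows "subst_to \<tau> (r / r') (z / z')"
proof -
  obtain p q where "r' = Fract p q" "peval \<tau> q \<noteq> 0" "z' = peval \<tau> p / peval \<tau> q"
    using assms(2) by (auto simp: subst_to_def)
  then have "inverse r' = Fract q p" "peval \<tau> p \<noteq> 0" "inverse z' = peval \<tau> q / peval \<tau> p"
    using assms(3) by auto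
  then have "subst_to \<tau> (inverse r') (inverse z')"
    unfolding subst_to_def by blast
  from subst_to_mult[OF assms(1) this] show ?thesis
    by (simp add: divide_inverse)
qed

lemma subst_to_sum:
  assumes "\<And>x. x \<in> A \<Longrightarrow> subst_to \<tau> (f x) (g x)"
  shows "subst_to \<tau> (sum f A) (sum g A)"
  using assms
  by (induction A rule: infinite_finite_induct) (auto intro: subst_to_0 subst_to_add)

section \<open>Coefficients of Zinbiel elements\<close>

text \<open>
  Weights for which no denominator \<open>u\<^sub>S\<close> below vanishes.
\<close>

definition generic :: "('a \<Rightarrow> ratfun) \<Rightarrow> bool" where
  "generic v \<longleftrightarrow> (\<forall>S. finite S \<longrightarrow> S \<noteq> {} \<longrightarrow> sum v S \<noteq> 0)"

lemma genericD: "generic v \<Longrightarrow> finite S \<Longrightarrow> S \<noteq> {} \<Longrightarrow> sum v S \<noteq> 0"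
  by (simp add: generic_def)

text \<open>
  The product transported from Zinbiel elements to their multilinear coefficients. With
  \<open>D\<close> multiplying the component of index \<open>S\<close> by the weight of \<open>S\<close>, it is
  \<open>F \<prec> G = D\<^sup>-\<^sup>1 (D F \<cdot> G)\<close>, where the dot is convolution over disjoint unions: an
  integral of a derivative times a function, which is the prototype of a Zinbiel product.
\<close>

definition conv :: "('a \<Rightarrow> ratfun) \<Rightarrow> ('a set \<Rightarrow> ratfun) \<Rightarrow> ('a set \<Rightarrow> ratfun) \<Rightarrow> 'a set \<Rightarrow> ratfun" where
  "conv v F G S = (\<Sum>A\<in>Pow S. sum v A / sum v S * F A * G (S - A))"

primrec tcoef :: "('a \<Rightarrow> ratfun) \<Rightarrow> 'a zterm \<Rightarrow> 'a set \<Rightarrow> ratfun" where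
  "tcoef v (ZGen x) = (\<lambda>S. if S = {x} then 1 / v x else 0)"
| "tcoef v ZZero = (\<lambda>S. 0)"
| "tcoef v (ZAdd a b) = (\<lambda>S. tcoef v a S + tcoef v b S)"
| "tcoef v (ZScale r a) = (\<lambda>S. rconst r * tcoef v a S)"
| "tcoef v (ZPrec a b) = conv v (tcoef v a) (tcoef v b)"

lemma conv_empty: "conv v F G {} = 0"
  by (simp add: conv_def)

lemma tcoef_empty: "tcoef v a {} = 0"
  by (induction a) (simp_all add: conv_empty)

lemma conv_infinite: "infinite S \<Longrightarrow> conv v F G S = 0"
  by (simp add: conv_def)

text \<open>
  Since \<open>D\<close> is a derivation for convolution, \<open>G \<prec> H + H \<prec> G\<close> is the convolution
  \<open>G \<cdot> H\<close>, and both sides become \<open>D\<^sup>-\<^sup>1 (D F \<cdot> G \<cdot> H)\<close>. The operator \<open>D\<close> is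
  invertible only away from the empty set, whence the two hypotheses on the components there.
\<close>

lemma conv_zinbiel:
  assumes v: "generic v" and G: "G {} = 0" and H: "H {} = 0"
  shows "conv v (conv v F G) H S = conv v F (conv v G H) S + conv v F (conv v H G) S"
proof (cases "finite S")
  case False
  then show ?thesis by (simp add: conv_infinite)
next
  case fin: True
  let ?s = "sum v"
  have "conv v (conv v F G) H S =
      (\<Sum>E\<in>Pow S. \<Sum>A\<in>Pow E. ?s A / ?s S * F A * G (E - A) * H (S - E))"
    unfolding conv_def sum_distrib_left sum_distrib_right
  proof (intro sum.cong HOL.refl)
    fix E A assume "E \<in> Pow S" "A \<in> Pow E"
    then have "E = {} \<or> ?s E \<noteq> 0"
      using genericD[OF v, of E] finite_subset[OF _ fin] by blast
    then show "?s E / ?s S * (?s A / ?s E * F A * G (E - A)) * H (S - E) =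
        ?s A / ?s S * F A * G (E - A) * H (S - E)"
      using \<open>A \<in> Pow E\<close> by auto
  qed
  also have "\<dots> = (\<Sum>(E, A)\<in>Sigma (Pow S) Pow. ?s A / ?s S * F A * G (E - A) * H (S - E))"
    using fin by (intro sum.Sigma) (auto intro: finite_subset)
  \<comment> \<open>\<open>E = A \<union> B\<close>: the sum now runs over the ordered partitions of \<open>S\<close> into three parts\<close>
  also have "\<dots> = (\<Sum>(A, B)\<in>Sigma (Pow S) (\<lambda>A. Pow (S - A)).
      ?s A / ?s S * F A * G B * H (S - A - B))"
  proof (rule sum.reindex_bij_witness[of _ "\<lambda>(A, B). (A \<union> B, A)" "\<lambda>(E, A). (A, E - A)"])
    fix p assume p: "p \<in> Sigma (Pow S) Pow"
    obtain E A where EA: "p = (E, A)"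
      by (cases p)
    have "S - A - (E - A) = S - E"
      using p EA by auto
    then show "(case case p of (E, A) \<Rightarrow> (A, E - A) of (A, B) \<Rightarrow>
          ?s A / ?s S * F A * G B * H (S - A - B)) =
        (case p of (E, A) \<Rightarrow> ?s A / ?s S * F A * G (E - A) * H (S - E))"
      by (simp add: EA)
  qed auto
  also have "\<dots> = (\<Sum>A\<in>Pow S. \<Sum>B\<in>Pow (S - A). ?s A / ?s S * F A * G B * H (S - A - B))"
    using fin by (intro sum.Sigma[symmetric]) auto
  also have "\<dots> = (\<Sum>A\<in>Pow S. ?s A / ?s S * F A * (conv v G H (S - A) + conv v H G (S - A)))"
  proof (intro sum.cong HOL.refl)
    fix A assume "A \<in> Pow S"
    show "(\<Sum>B\<in>Pow (S - A). ?s A / ?s S * F A * G B * H (S - A - B)) =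
        ?s A / ?s S * F A * (conv v G H (S - A) + conv v H G (S - A))"
    proof (cases "S - A = {}")
      case True
      show ?thesis
        unfolding True by (simp add: conv_empty G H)
    next
      case False
      let ?R = "S - A"
      have R: "?s ?R \<noteq> 0"
        using False fin v by (simp add: genericD)
      have "conv v H G ?R = (\<Sum>B\<in>Pow ?R. ?s (?R - B) / ?s ?R * H (?R - B) * G B)"
        unfolding conv_def
        by (rule sum.reindex_bij_witness[of _ "\<lambda>B. ?R - B" "\<lambda>B. ?R - B"])
          (auto simp: double_diff)
      then have "conv v G H ?R + conv v H G ?R =
          (\<Sum>B\<in>Pow ?R. (?s B + ?s (?R - B)) / ?s ?R * G B * H (?R - B))"
        by (simp only: conv_def[of v G] sum.distrib[symmetric])
          (intro sum.cong HOL.refl, simp add: add_divide_distrib algebra_simps)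
      also have "\<dots> = (\<Sum>B\<in>Pow ?R. G B * H (?R - B))"
      proof (intro sum.cong HOL.refl)
        fix B assume "B \<in> Pow ?R"
        then have "?s B + ?s (?R - B) = ?s ?R"
          using fin by (metis PowD add.commute finite_Diff sum.subset_diff)
        then show "(?s B + ?s (?R - B)) / ?s ?R * G B * H (?R - B) = G B * H (?R - B)"
          using R by simp
      qed
      finally show ?thesis
        by (simp add: sum_distrib_left mult.assoc)
    qed
  qed
  also have "\<dots> = conv v F (conv v G H) S + conv v F (conv v H G) S"
    by (simp only: conv_def[of v F] distrib_left sum.distrib)
  finally show ?thesis .
qed

lemma rconst_minus: "rconst (- a) = - rconst a"
  by (metis add.right_inverse add_eq_0_iff rconst_0 rconst_add)

lemma conv_add_left: "conv v (\<lambda>S. F S + F' S) G S = conv v F G S + conv v F' G S"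
  by (simp only: conv_def distrib_left distrib_right sum.distrib)

lemma conv_add_right: "conv v F (\<lambda>S. G S + G' S) S = conv v F G S + conv v F G' S"
  by (simp only: conv_def distrib_left sum.distrib)

lemma conv_scale_left: "conv v (\<lambda>S. c * F S) G S = c * conv v F G S"
  unfolding conv_def sum_distrib_left by (intro sum.cong HOL.refl) (simp add: mult_ac)

lemma conv_scale_right: "conv v F (\<lambda>S. c * G S) S = c * conv v F G S"
  unfolding conv_def sum_distrib_left by (intro sum.cong HOL.refl) (simp add: mult_ac)

lemma tcoef_zeq:
  assumes v: "generic v"
  shows "zeq a b \<Longrightarrow> tcoef v a S = tcoef v b S"
proof (induction arbitrary: S rule: zeq.induct)
  case (zinbiel a b c)
  show ?case
    by (simp add: conv_zinbiel[OF v] tcoef_empty)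
next
  case (trans a b c)
  then show ?case by metis
next
  case (cong_prec a a' b b')
  then have "tcoef v a = tcoef v a'" "tcoef v b = tcoef v b'"
    by (simp_all add: fun_eq_iff)
  then show ?case by simp
qed (simp_all add: conv_add_left conv_add_right conv_scale_left conv_scale_right
      rconst_add rconst_mult rconst_minus distrib_left distrib_right add_ac)

text \<open>
  The default value for nongeneric weights makes the function respect the congruence
  unconditionally, so that it descends to the quotient for all weights at once.
\<close>

lift_definition zcoef :: "('a \<Rightarrow> ratfun) \<Rightarrow> 'a zinbiel \<Rightarrow> 'a set \<Rightarrow> ratfun" is
  "\<lambda>v a S. if generic v then tcoef v a S else 0"
  by (simp add: fun_eq_iff) (metis tcoef_zeq)

lemma zinbiel_induct [case_names gen zero add scale prec]:
  assumes "\<And>x. P (zgen x)" "P 0" "\<And>a b. P a \<Longrightarrow> P b \<Longrightarrow> P (a + b)"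
    "\<And>r a. P a \<Longrightarrow> P (zscale r a)" "\<And>a b. P a \<Longrightarrow> P b \<Longrightarrow> P (a \<prec>\<^sub>Z b)"
  shows "P a"
proof (induction a rule: zinbiel.abs_induct)
  case (1 t)
  show ?case
  proof (induction t)
    case (ZGen x)
    then show ?case using assms(1) by (simp add: zgen.abs_eq)
  next
    case ZZero
    then show ?case using assms(2) by (simp add: zero_zinbiel.abs_eq)
  next
    case (ZAdd t1 t2)
    from assms(3)[OF this] show ?case by (simp add: plus_zinbiel.abs_eq)
  next
    case (ZScale r t)
    from assms(4)[OF this] show ?case by (simp add: zscale.abs_eq)
  next
    case (ZPrec t1 t2)
    from assms(5)[OF this] show ?case by (simp add: zprec.abs_eq)
  qed
qed

context
  fixes v :: "'a \<Rightarrow> ratfun"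
  assumes v: "generic v"
begin

lemma zcoef_gen: "zcoef v (zgen x) S = (if S = {x} then 1 / v x else 0)"
  by (simp add: zcoef.abs_eq zgen.abs_eq v)

lemma zcoef_0: "zcoef v 0 S = 0"
  by (simp add: zcoef.abs_eq zero_zinbiel.abs_eq)

lemma zcoef_add: "zcoef v (a + b) S = zcoef v a S + zcoef v b S"
  by (induction a rule: zinbiel.abs_induct, induction b rule: zinbiel.abs_induct)
    (simp add: zcoef.abs_eq plus_zinbiel.abs_eq)

lemma zcoef_scale: "zcoef v (zscale r a) S = rconst r * zcoef v a S"
  by (induction a rule: zinbiel.abs_induct) (simp add: zcoef.abs_eq zscale.abs_eq)

lemma zcoef_prec: "zcoef v (a \<prec>\<^sub>Z b) S = conv v (zcoef v a) (zcoef v b) S"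
  by (induction a rule: zinbiel.abs_induct, induction b rule: zinbiel.abs_induct)
    (simp add: zcoef.abs_eq[abs_def] zprec.abs_eq v)

end

text \<open>
  Sending one variable of \<open>S\<close> to \<open>1\<close> and the others to \<open>0\<close> sends the sum over
  \<open>S\<close> to \<open>1\<close>.
\<close>

lemma generic_uvar: "generic uvar"
  unfolding generic_def
proof (intro allI impI notI)
  fix S :: "nat set"
  assume S: "finite S" "S \<noteq> {}" and 0: "sum uvar S = 0"
  obtain j where j: "j \<in> S"
    using S by blast
  let ?\<tau> = "\<lambda>k. if k = j then 1 else 0 :: ratfun"
  have "subst_to ?\<tau> (sum uvar S) (sum ?\<tau> S)"
    by (intro subst_to_sum subst_to_uvar)
  moreover have "sum ?\<tau> S = 1"
    using S j by simp
  ultimately show False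
    using 0 subst_to_unique[OF subst_to_0] by fastforce
qed

lemma generic_blocks:
  fixes T :: "'a \<Rightarrow> 'b set"
  assumes u: "generic u" and T: "\<And>x. finite (T x)" "\<And>x. T x \<noteq> {}"
    and disj: "\<And>x y. x \<noteq> y \<Longrightarrow> T x \<inter> T y = {}"
  shows "generic (\<lambda>x. sum u (T x))"
  unfolding generic_def
proof (intro allI impI)
  fix S :: "'a set" assume S: "finite S" "S \<noteq> {}"
  have "(\<Sum>x\<in>S. sum u (T x)) = sum u (\<Union>x\<in>S. T x)"
    using S T disj by (subst sum.UNION_disjoint) auto
  also have "\<dots> \<noteq> 0"
    using S T by (intro genericD[OF u]) auto
  finally show "(\<Sum>x\<in>S. sum u (T x)) \<noteq> 0" .
qed

lemma subst_to_zcoef: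
  assumes \<tau>: "generic \<tau>"
  shows "subst_to \<tau> (zcoef uvar a S) (zcoef \<tau> a S)"
proof (induction a arbitrary: S rule: zinbiel_induct)
  case (gen x)
  have "\<tau> x \<noteq> 0"
    using genericD[OF \<tau>, of "{x}"] by simp
  then show ?case
    by (auto simp: zcoef_gen generic_uvar \<tau> intro: subst_to_0 subst_to_divide subst_to_1 subst_to_uvar)
next
  case zero
  show ?case by (simp add: zcoef_0 generic_uvar \<tau> subst_to_0)
next
  case (add a b)
  then show ?case by (simp add: zcoef_add generic_uvar \<tau> subst_to_add)
next
  case (scale r a)
  then show ?case by (simp add: zcoef_scale generic_uvar \<tau> subst_to_mult subst_to_rconst)
next
  case (prec a b)
  show ?case
  proof (cases "finite S \<and> S \<noteq> {}")
    case True
    then show ?thesis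
      unfolding zcoef_prec[OF generic_uvar] zcoef_prec[OF \<tau>] conv_def
      by (intro subst_to_sum subst_to_mult subst_to_divide prec.IH subst_to_uvar genericD[OF \<tau>]) auto
  next
    case False
    then show ?thesis
      by (auto simp: zcoef_prec generic_uvar \<tau> conv_infinite conv_empty subst_to_0)
  qed
qed

section \<open>Substitution of homogeneous elements\<close>

lemma zsubst_simps:
  "zsubst \<theta> (zgen x) = \<theta> x"
  "zsubst \<theta> 0 = 0"
  "zsubst \<theta> (a + b) = zsubst \<theta> a + zsubst \<theta> b"
  "zsubst \<theta> (zscale r a) = zscale r (zsubst \<theta> a)"
  "zsubst \<theta> (a \<prec>\<^sub>Z b) = zsubst \<theta> a \<prec>\<^sub>Z zsubst \<theta> b"
  by ((induction a rule: zinbiel.abs_induct)?, (induction b rule: zinbiel.abs_induct)?,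
      simp add: zsubst.abs_eq zgen.abs_eq zero_zinbiel.abs_eq plus_zinbiel.abs_eq
        zscale.abs_eq zprec.abs_eq)+

text \<open>
  The reason for the compatibility with compositions. If the element substituted for \<open>x\<close> is
  concentrated on the block \<open>T x\<close>, then splitting a union of blocks into two parts amounts to
  splitting the index set, and the weight of a union of blocks is the sum of the weights of the
  blocks. So the coefficient of the result is that of \<open>a\<close> for the block weights, up to a
  factor for each block; the weight of the block occurs in this factor because it cancels the
  denominator of the coefficient of a generator.
\<close>

lemma zcoef_zsubst:
  fixes \<theta> :: "'a \<Rightarrow> 'b zinbiel" and T :: "'a \<Rightarrow> 'b set"
  assumes u: "generic u" and T: "\<And>x. finite (T x)" "\<And>x. T x \<noteq> {}"
    and disj: "\<And>x y. x \<noteq> y \<Longrightarrow> T x \<inter> T y = {}"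
    and \<theta>: "\<And>x S. S \<noteq> T x \<Longrightarrow> zcoef u (\<theta> x) S = 0"
  defines "v \<equiv> \<lambda>x. sum u (T x)"
  shows "(\<nexists>X. S = \<Union> (T ` X)) \<Longrightarrow> zcoef u (zsubst \<theta> a) S = 0"
    and "finite X \<Longrightarrow> zcoef u (zsubst \<theta> a) (\<Union> (T ` X)) =
      (\<Prod>x\<in>X. v x * zcoef u (\<theta> x) (T x)) * zcoef v a X"
proof -
  have v: "generic v"
    unfolding v_def by (rule generic_blocks[OF u T disj])
  have eqI: "x = y" if "t \<in> T x" "t \<in> T y" for t x y
    using disj[of x y] that by (cases "x = y") auto
  have T_subset: "Y \<subseteq> X" if "\<Union> (T ` Y) \<subseteq> \<Union> (T ` X)" for X Y
  proof
    fix y assume "y \<in> Y"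
    moreover obtain t where "t \<in> T y"
      using T by blast
    ultimately obtain x where "x \<in> X" "t \<in> T x" "t \<in> T y"
      using \<open>\<Union> (T ` Y) \<subseteq> \<Union> (T ` X)\<close> by blast
    then show "y \<in> X"
      using eqI by metis
  qed
  have T_diff: "\<Union> (T ` X) - \<Union> (T ` Y) = \<Union> (T ` (X - Y))" for X Y
    using eqI by auto
  have T_sum: "sum u (\<Union> (T ` X)) = sum v X" if "finite X" for X
    unfolding v_def using that T disj by (subst sum.UNION_disjoint) auto
  define c where "c = (\<lambda>x. v x * zcoef u (\<theta> x) (T x))"
  have "((\<nexists>X. S = \<Union> (T ` X)) \<longrightarrow> zcoef u (zsubst \<theta> a) S = 0) \<and>
      (finite X \<longrightarrow> zcoef u (zsubst \<theta> a) (\<Union> (T ` X)) = prod c X * zcoef v a X)" for S X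
  proof (induction a arbitrary: S X rule: zinbiel_induct)
    case (gen x)
    have "zcoef u (\<theta> x) S = 0" if "\<nexists>X. S = \<Union> (T ` X)"
    proof (rule \<theta>)
      show "S \<noteq> T x"
        using that by (metis UN_insert UN_empty Un_empty_right)
    qed
    moreover have "zcoef u (\<theta> x) (\<Union> (T ` X)) = prod c X * zcoef v (zgen x) X"
    proof (cases "X = {x}")
      case True
      have "v x \<noteq> 0"
        using genericD[OF v, of "{x}"] by simp
      then show ?thesis
        using True by (simp add: zcoef_gen v c_def)
    next
      case False
      have "\<Union> (T ` X) \<noteq> T x"
        using False T_subset[of X "{x}"] T_subset[of "{x}" X] by auto
      then show ?thesis
        using False by (simp add: zcoef_gen v \<theta>)
    qed
    ultimately show ?case by (simp add: zsubst_simps)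
  next
    case zero
    show ?case by (simp add: zsubst_simps zcoef_0 u v)
  next
    case (add a b)
    then show ?case by (simp add: zsubst_simps zcoef_add u v distrib_left)
  next
    case (scale r a)
    then show ?case by (simp add: zsubst_simps zcoef_scale u v)
  next
    case (prec a b)
    let ?F = "zcoef u (zsubst \<theta> a)" and ?G = "zcoef u (zsubst \<theta> b)"
    have F0: "?F A = 0" if "\<nexists>Y. A = \<Union> (T ` Y)" for A
      using prec.IH(1) that by blast
    have G0: "?G A = 0" if "\<nexists>Y. A = \<Union> (T ` Y)" for A
      using prec.IH(2) that by blast
    have "conv u ?F ?G S = 0" if S: "\<nexists>X. S = \<Union> (T ` X)"
      unfolding conv_def
    proof (intro sum.neutral ballI)
      fix A assume "A \<in> Pow S"
      have "?F A = 0 \<or> ?G (S - A) = 0"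
      proof (rule ccontr)
        assume "\<not> ?thesis"
        then obtain Y Z where YZ: "A = \<Union> (T ` Y)" "S - A = \<Union> (T ` Z)"
          using F0[of A] G0[of "S - A"] by blast
        have "S = A \<union> (S - A)"
          using \<open>A \<in> Pow S\<close> by auto
        then have "S = \<Union> (T ` (Y \<union> Z))"
          unfolding YZ(2) by (simp add: YZ(1) Un_commute)
        then show False
          using S by blast
      qed
      then show "sum u A / sum u S * ?F A * ?G (S - A) = 0"
        by auto
    qed
    moreover have "conv u ?F ?G (\<Union> (T ` X)) = prod c X * conv v (zcoef v a) (zcoef v b) X"
      if X: "finite X"
    proof -
      let ?U = "\<lambda>Y. \<Union> (T ` Y)"
      let ?f = "\<lambda>A. sum u A / sum u (?U X) * ?F A * ?G (?U X - A)"
      have inj: "inj_on ?U (Pow X)"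
        by (rule inj_onI) (intro equalityI T_subset, simp_all)
      have fin: "finite (Pow (?U X))"
        using X T by simp
      have "sum ?f (Pow (?U X)) = sum ?f (?U ` Pow X)"
      proof (rule sum.mono_neutral_right[OF fin])
        show "?U ` Pow X \<subseteq> Pow (?U X)"
          by auto
        show "\<forall>A\<in>Pow (?U X) - ?U ` Pow X. ?f A = 0"
        proof
          fix A assume A: "A \<in> Pow (?U X) - ?U ` Pow X"
          have "\<nexists>Y. A = ?U Y"
          proof
            assume "\<exists>Y. A = ?U Y"
            then obtain Y where "A = ?U Y" by blast
            then show False
              using A T_subset[of Y X] by blast
          qed
          then show "?f A = 0"
            using F0 by simp
        qed
      qed
      also have "\<dots> = (\<Sum>Y\<in>Pow X. ?f (?U Y))"
        by (simp add: sum.reindex[OF inj])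
      also have "\<dots> = (\<Sum>Y\<in>Pow X.
          prod c X * (sum v Y / sum v X * zcoef v a Y * zcoef v b (X - Y)))"
      proof (intro sum.cong HOL.refl)
        fix Y assume "Y \<in> Pow X"
        then have Y: "finite Y" "finite (X - Y)" "Y \<subseteq> X"
          using X by (auto intro: finite_subset)
        have "?F (?U Y) = prod c Y * zcoef v a Y" "?G (?U (X - Y)) = prod c (X - Y) * zcoef v b (X - Y)"
          using prec.IH Y by blast+
        moreover have "prod c X = prod c (X - Y) * prod c Y"
          by (rule prod.subset_diff) (use Y X in auto)
        ultimately show "?f (?U Y) =
            prod c X * (sum v Y / sum v X * zcoef v a Y * zcoef v b (X - Y))"
          using X Y by (simp add: T_diff T_sum)
      qed
      finally show ?thesis
        by (simp add: conv_def sum_distrib_left)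
    qed
    ultimately show ?case
      by (simp add: zsubst_simps zcoef_prec u v)
  qed
  then show "(\<nexists>X. S = \<Union> (T ` X)) \<Longrightarrow> zcoef u (zsubst \<theta> a) S = 0"
    and "finite X \<Longrightarrow> zcoef u (zsubst \<theta> a) (\<Union> (T ` X)) =
      (\<Prod>x\<in>X. v x * zcoef u (\<theta> x) (T x)) * zcoef v a X"
    by (auto simp: c_def)
qed

text \<open>
  Multilinear elements on an arbitrary set of generators: those on \<open>{1..n}\<close> form arity
  \<open>n\<close>, and those on other sets are what substitution produces.
\<close>

definition homog :: "'a set \<Rightarrow> 'a zinbiel set" where
  "homog A = zb_span {a. zmono A a}"

lemma homog_induct [consumes 1, case_names zero step]:
  assumes "a \<in> homog A" "P 0"
    "\<And>r m b. zmono A m \<Longrightarrow> b \<in> homog A \<Longrightarrow> P b \<Longrightarrow> P (zscale r m + b)"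
  shows "P a"
proof -
  have "P a \<and> a \<in> homog A"
    using assms(1) unfolding homog_def
    by (induction rule: zb.span_induct_alt)
      (use assms(2,3) in \<open>auto simp: homog_def intro: zb.span_zero zb.span_add zb.span_scale zb.span_base\<close>)
  then show ?thesis ..
qed

lemma homog_0: "0 \<in> homog A"
  and homog_add: "a \<in> homog A \<Longrightarrow> b \<in> homog A \<Longrightarrow> a + b \<in> homog A"
  and homog_scale: "a \<in> homog A \<Longrightarrow> zscale r a \<in> homog A"
  and homog_mono: "zmono A a \<Longrightarrow> a \<in> homog A"
  unfolding homog_def by (auto intro: zb.span_zero zb.span_add zb.span_scale zb.span_base)

lemma zprec_0: "0 \<prec>\<^sub>Z b = 0" "a \<prec>\<^sub>Z 0 = 0"
  using zprec_bilinear(3)[of 0 0 b] zprec_bilinear(4)[of a 0 0] by simp_all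

lemma span_prec:
  assumes prec: "\<And>m m'. m \<in> M \<Longrightarrow> m' \<in> M' \<Longrightarrow> m \<prec>\<^sub>Z m' \<in> zb_span N"
    and a: "a \<in> zb_span M" and b: "b \<in> zb_span M'"
  shows "a \<prec>\<^sub>Z b \<in> zb_span N"
  using a
proof (induction rule: zb.span_induct_alt)
  case base
  show ?case by (simp add: zprec_0 zb.span_zero)
next
  case (step r m a)
  have "m \<prec>\<^sub>Z b \<in> zb_span N"
    using b
  proof (induction rule: zb.span_induct_alt)
    case base
    show ?case by (simp add: zprec_0 zb.span_zero)
  next
    case (step r' m' b)
    then show ?case
      using prec[OF \<open>m \<in> M\<close>] by (simp add: zprec_bilinear zb.span_add zb.span_scale)
  qed
  then show ?case
    using step by (simp add: zprec_bilinear zb.span_add zb.span_scale)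
qed

lemma homog_prec:
  assumes "a \<in> homog A" "b \<in> homog B" "A \<inter> B = {}"
  shows "a \<prec>\<^sub>Z b \<in> homog (A \<union> B)"
  using assms unfolding homog_def
  by (elim span_prec[rotated]) (auto intro: zb.span_base zmono.prec)

lemma homog_zsubst:
  assumes \<theta>: "\<And>x. \<theta> x \<in> homog (T x)"
    and disj: "\<And>x y. x \<noteq> y \<Longrightarrow> T x \<inter> T y = {}"
    and a: "a \<in> homog A"
  shows "zsubst \<theta> a \<in> homog (\<Union> (T ` A))"
proof -
  have mono: "zsubst \<theta> m \<in> homog (\<Union> (T ` A))" if "zmono A m" for A m
    using that
  proof (induction rule: zmono.induct)
    case (gen x)
    then show ?case using \<theta> by (simp add: zsubst_simps)
  next
    case (prec A a B b)
    have "x \<noteq> y" if "x \<in> A" "y \<in> B" for x y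
      using that prec by blast
    then have "\<Union> (T ` A) \<inter> \<Union> (T ` B) = {}"
      using disj by (auto simp: Int_UN_distrib2)
    with prec show ?case
      by (simp add: zsubst_simps homog_prec image_Un)
  qed
  show ?thesis
    using a by (induction rule: homog_induct)
      (simp_all add: zsubst_simps homog_0 homog_add homog_scale mono)
qed

lemma zcoef_homog:
  assumes v: "generic v" and a: "a \<in> homog A" and S: "S \<noteq> A"
  shows "zcoef v a S = 0"
proof -
  have mono: "zcoef v m S = 0" if "zmono A m" "S \<noteq> A" for A m S
    using that
  proof (induction arbitrary: S rule: zmono.induct)
    case (gen x)
    then show ?case by (simp add: zcoef_gen v)
  next
    case (prec A a B b)
    have "zcoef v a E = 0 \<or> zcoef v b (S - E) = 0" if "E \<subseteq> S" for E
    proof (cases "E = A")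
      case True
      then have "S - E \<noteq> B"
        using prec.prems that by blast
      then show ?thesis
        using prec.IH(2) by simp
    qed (use prec.IH(1) in simp)
    then show ?case
      unfolding zcoef_prec[OF v] conv_def by (intro sum.neutral) auto
  qed
  show ?thesis
    using a by (induction rule: homog_induct)
      (simp_all add: zcoef_0 zcoef_add zcoef_scale v mono S)
qed

section \<open>Words\<close>

lemma zword_Cons: "ys \<noteq> [] \<Longrightarrow> zword (x # ys) = zgen x \<prec>\<^sub>Z zword ys"
  by (cases ys) simp_all

lemma zmono_zword: "distinct l \<Longrightarrow> l \<noteq> [] \<Longrightarrow> zmono (set l) (zword l)"
proof (induction l)
  case (Cons x l)
  show ?case
  proof (cases "l = []")
    case True
    then show ?thesis by (simp add: zmono.gen)
  next
    case False
    then have "zmono ({x} \<union> set l) (zgen x \<prec>\<^sub>Z zword l)"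
      using Cons by (intro zmono.prec zmono.gen) auto
    then show ?thesis
      using False by (simp add: zword_Cons)
  qed
qed simp

lemma zmono_nonempty: "zmono A a \<Longrightarrow> A \<noteq> {}"
  by (induction rule: zmono.induct) auto

abbreviation words :: "'a set \<Rightarrow> 'a zinbiel set" where
  "words A \<equiv> zword ` permutations_of_set A"

lemma zgen_prec_words:
  assumes a: "a \<in> zb_span (words A)" and x: "x \<notin> A" and A: "A \<noteq> {}"
  shows "zgen x \<prec>\<^sub>Z a \<in> zb_span (words (insert x A))"
proof (rule span_prec[OF _ zb.span_base[of _ "{zgen x}"] a])
  fix m m' assume "m \<in> {zgen x}" "m' \<in> words A"
  then obtain l where l: "l \<in> permutations_of_set A" "m = zgen x" "m' = zword l"
    by auto
  have "l \<noteq> []"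
    using l A by (auto simp: permutations_of_set_def)
  then have "m \<prec>\<^sub>Z m' = zword (x # l)"
    using l by (simp add: zword_Cons)
  moreover have "x # l \<in> permutations_of_set (insert x A)"
    using l x by (auto simp: permutations_of_set_def)
  ultimately show "m \<prec>\<^sub>Z m' \<in> zb_span (words (insert x A))"
    by (simp add: zb.span_base)
qed simp

text \<open>
  With \<open>xs = x # xs'\<close>, the Zinbiel identity turns \<open>(x \<prec> xs') \<prec> ys\<close> into \<open>x\<close> times
  the sum of \<open>xs' \<prec> ys\<close> and \<open>ys \<prec> xs'\<close>, which are shorter products; unfolding this is the
  recursion for the half-shuffle.
\<close>

lemma zword_prec_zword:
  assumes "distinct (xs @ ys)" "xs \<noteq> []" "ys \<noteq> []"
  shows "zword xs \<prec>\<^sub>Z zword ys \<in> zb_span (words (set xs \<union> set ys))"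
  using assms
proof (induction "length xs + length ys" arbitrary: xs ys rule: less_induct)
  case less
  obtain x xs' where xs: "xs = x # xs'"
    using less.prems by (cases xs) auto
  show ?case
  proof (cases "xs' = []")
    case True
    have "x # ys \<in> permutations_of_set (set xs \<union> set ys)"
      using less.prems xs True by (auto simp: permutations_of_set_def)
    moreover have "zword xs \<prec>\<^sub>Z zword ys = zword (x # ys)"
      using less.prems xs True by (simp add: zword_Cons)
    ultimately show ?thesis
      by (simp add: zb.span_base)
  next
    case False
    let ?A = "set xs' \<union> set ys"
    have "zword xs' \<prec>\<^sub>Z zword ys \<in> zb_span (words ?A)"
      using less.prems xs False by (intro less.hyps) auto
    moreover have "zword ys \<prec>\<^sub>Z zword xs' \<in> zb_span (words (set ys \<union> set xs'))"
      using less.prems xs False by (intro less.hyps) auto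
    moreover have "zword xs \<prec>\<^sub>Z zword ys =
        zgen x \<prec>\<^sub>Z (zword xs' \<prec>\<^sub>Z zword ys) + zgen x \<prec>\<^sub>Z (zword ys \<prec>\<^sub>Z zword xs')"
      using xs False by (simp add: zword_Cons zprec_zinbiel)
    moreover have "x \<notin> ?A" "?A \<noteq> {}" "set xs \<union> set ys = insert x ?A"
      using less.prems xs by auto
    ultimately show ?thesis
      by (simp add: zgen_prec_words zb.span_add Un_commute)
  qed
qed

lemma zmono_words: "zmono A a \<Longrightarrow> a \<in> zb_span (words A)"
proof (induction rule: zmono.induct)
  case (gen x)
  then show ?case by (auto intro: zb.span_base)
next
  case (prec A a B b)
  show ?case
  proof (rule span_prec[OF _ prec.IH])
    fix m m' assume "m \<in> words A" "m' \<in> words B"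
    then obtain xs ys where l: "set xs = A" "distinct xs" "m = zword xs"
        "set ys = B" "distinct ys" "m' = zword ys"
      by (auto simp: permutations_of_set_def)
    moreover have "xs \<noteq> []" "ys \<noteq> []"
      using l zmono_nonempty[OF prec.hyps(1)] zmono_nonempty[OF prec.hyps(2)] by auto
    ultimately show "m \<prec>\<^sub>Z m' \<in> zb_span (words (A \<union> B))"
      using zword_prec_zword[of xs ys] prec.hyps(3) by simp
  qed
qed

lemma homog_eq_span_words:
  assumes "A \<noteq> {}"
  shows "homog A = zb_span (words A)"
proof (rule subset_antisym)
  show "homog A \<subseteq> zb_span (words A)"
    unfolding homog_def by (intro zb.span_minimal zb.subspace_span) (auto intro: zmono_words)
  have "words A \<subseteq> {a. zmono A a}"
    using assms zmono_zword by (fastforce simp: permutations_of_set_def)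
  then show "zb_span (words A) \<subseteq> homog A"
    unfolding homog_def by (rule zb.span_mono)
qed

lemma span_image_sum:
  assumes "finite I" "a \<in> zb_span (f ` I)"
  obtains c where "a = (\<Sum>i\<in>I. zscale (c i) (f i))"
proof -
  have "\<exists>c. a = (\<Sum>i\<in>I. zscale (c i) (f i))"
    using assms(2)
  proof (induction rule: zb.span_induct_alt)
    case base
    have "0 = (\<Sum>i\<in>I. zscale 0 (f i))"
      by simp
    then show ?case by (intro exI)
  next
    case (step r x a)
    then obtain k c where k: "k \<in> I" "x = f k" and c: "a = (\<Sum>i\<in>I. zscale (c i) (f i))"
      by auto
    have "zscale r x = (\<Sum>i\<in>I. zscale (if i = k then r else 0) (f i))"
      using k assms(1) by (simp add: if_distrib[of "\<lambda>r. zscale r _"] cong: if_cong)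
    then have "zscale r x + a = (\<Sum>i\<in>I. zscale ((if i = k then r else 0) + c i) (f i))"
      unfolding c by (simp only: zb.scale_left_distrib sum.distrib)
    then show ?case by (intro exI)
  qed
  then show ?thesis
    using that by blast
qed

text \<open>
  The function \<open>f\<close> of the mirror image of a word, written without reversing the word: the
  denominators are the sums over the suffixes.
\<close>

primrec suffix_frac :: "nat list \<Rightarrow> ratfun" where
  "suffix_frac [] = 1"
| "suffix_frac (x # xs) = suffix_frac xs / sum uvar (set (x # xs))"

lemma zcoef_zword:
  "distinct l \<Longrightarrow> l \<noteq> [] \<Longrightarrow> zcoef uvar (zword l) (set l) = suffix_frac l"
proof (induction l)
  case (Cons x l)
  show ?case
  proof (cases "l = []")
    case True
    then show ?thesis by (simp add: zcoef_gen generic_uvar)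
  next
    case False
    let ?S = "set (x # l)"
    have "uvar x \<noteq> 0"
      using genericD[OF generic_uvar, of "{x}"] by simp
    have "zcoef uvar (zword (x # l)) ?S = (\<Sum>A\<in>Pow ?S.
        if A = {x} then uvar x / sum uvar ?S * (1 / uvar x) * zcoef uvar (zword l) (?S - {x}) else 0)"
      unfolding zword_Cons[OF False] zcoef_prec[OF generic_uvar] conv_def zcoef_gen[OF generic_uvar]
      by (intro sum.cong HOL.refl) simp
    also have "\<dots> = uvar x / sum uvar ?S * (1 / uvar x) * zcoef uvar (zword l) (?S - {x})"
      by simp
    also have "?S - {x} = set l"
      using Cons.prems by auto
    finally show ?thesis
      using Cons False \<open>uvar x \<noteq> 0\<close> by simp
  qed
qed simp

section \<open>Linear independence\<close>

text \<open>
  Independence is read off from residues: \<open>u\<^sub>j\<close> occurs as a denominator exactly for the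
  words that end in \<open>j\<close>, so multiplying by \<open>u\<^sub>j\<close> and then setting \<open>u\<^sub>j = 0\<close> keeps just
  these words, with their last letter removed.
\<close>

definition kill :: "nat \<Rightarrow> nat \<Rightarrow> ratfun" where
  "kill j = (\<lambda>k. if k = j then 0 else uvar k)"

lemma sum_kill: "finite S \<Longrightarrow> sum (kill j) S = sum uvar (S - {j})"
  by (rule sum.mono_neutral_cong_right) (auto simp: kill_def)

lemma sum_kill_nonzero: "finite S \<Longrightarrow> S - {j} \<noteq> {} \<Longrightarrow> sum (kill j) S \<noteq> 0"
  unfolding sum_kill by (intro genericD[OF generic_uvar]) auto

lemma subst_to_kill_regular:
  assumes "j \<notin> set l"
  shows "subst_to (kill j) (suffix_frac l) (suffix_frac l)"
  using assms
proof (induction l)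
  case (Cons x l)
  have "subst_to (kill j) (suffix_frac (x # l)) (suffix_frac l / sum (kill j) (set (x # l)))"
    unfolding suffix_frac.simps
    using Cons by (intro subst_to_divide subst_to_sum subst_to_uvar sum_kill_nonzero) auto
  moreover have "sum (kill j) (set (x # l)) = sum uvar (set (x # l))"
    using Cons.prems by (subst sum_kill) auto
  ultimately show ?case by simp
qed (simp add: subst_to_1)

lemma subst_to_kill_residue:
  assumes "distinct l" "j \<in> set l"
  shows "subst_to (kill j) (uvar j * suffix_frac l)
    (if last l = j then suffix_frac (butlast l) else 0)"
  using assms
proof (induction l)
  case (Cons x l)
  show ?case
  proof (cases "l = []")
    case True
    have "uvar j \<noteq> 0"
      using genericD[OF generic_uvar, of "{j}"] by simp
    then show ?thesis
      using True Cons.prems by (simp add: subst_to_1)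
  next
    case False
    let ?s = "sum (kill j) (set (x # l))"
    have "hd l \<in> set l" "x \<notin> set l"
      using False Cons.prems(1) by simp_all
    then have "set (x # l) - {j} \<noteq> {}"
      by (metis Diff_iff empty_iff insertCI list.simps(15) singletonD)
    then have s: "?s \<noteq> 0"
      by (intro sum_kill_nonzero) auto
    have sub_s: "subst_to (kill j) (sum uvar (set (x # l))) ?s"
      by (intro subst_to_sum subst_to_uvar)
    show ?thesis
    proof (cases "x = j")
      case True
      then have "subst_to (kill j) (suffix_frac l) (suffix_frac l)"
        using Cons.prems by (intro subst_to_kill_regular) auto
      moreover have "subst_to (kill j) (uvar j) 0"
        using subst_to_uvar[of "kill j" j] by (simp add: kill_def)
      ultimately have "subst_to (kill j) (uvar j * (suffix_frac l / sum uvar (set (x # l))))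
          (0 * (suffix_frac l / ?s))"
        by (intro subst_to_mult subst_to_divide sub_s s)
      moreover have "last (x # l) \<noteq> j"
        using True False Cons.prems last_in_set[of l] by auto
      ultimately show ?thesis by simp
    next
      case x: False
      then have "subst_to (kill j) (uvar j * suffix_frac l)
          (if last l = j then suffix_frac (butlast l) else 0)"
        using Cons by simp
      from subst_to_divide[OF this sub_s s]
      have *: "subst_to (kill j) (uvar j * suffix_frac (x # l))
          ((if last l = j then suffix_frac (butlast l) else 0) / ?s)"
        by simp
      have "?s = sum uvar (set (x # butlast l))" if "last l = j"
      proof -
        have l: "l = butlast l @ [j]"
          using that False by (metis append_butlast_last_id)
        then have "distinct (butlast l @ [j])"
          using Cons.prems(1) by simp
        then have "j \<notin> set (butlast l)"
          by simp
        moreover have "set l = insert j (set (butlast l))"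
          by (subst l) simp
        ultimately have "set (x # l) - {j} = set (x # butlast l)"
          using x by auto
        then show ?thesis
          by (simp add: sum_kill)
      qed
      then show ?thesis
        using * False by (cases "last l = j") simp_all
    qed
  qed
qed simp

lemma permutations_of_set_snoc:
  assumes j: "j \<in> S"
  shows "bij_betw (\<lambda>m. m @ [j]) (permutations_of_set (S - {j}))
    {l \<in> permutations_of_set S. last l = j}"
  unfolding bij_betw_def
proof (intro conjI subset_antisym subsetI)
  show "inj_on (\<lambda>m. m @ [j]) (permutations_of_set (S - {j}))"
    by (simp add: inj_on_def)
next
  fix l assume "l \<in> (\<lambda>m. m @ [j]) ` permutations_of_set (S - {j})"
  then obtain m where "l = m @ [j]" "set m = S - {j}" "distinct m"
    by (auto simp: permutations_of_set_def)
  then show "l \<in> {l \<in> permutations_of_set S. last l = j}"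
    using j by (simp add: permutations_of_set_def insert_absorb)
next
  fix l assume l: "l \<in> {l \<in> permutations_of_set S. last l = j}"
  then have "l \<noteq> []"
    using j by (auto simp: permutations_of_set_def)
  then obtain k i where k: "l = k @ [i]"
    by (metis rev_exhaust)
  then have "i = j" "k \<in> permutations_of_set (S - {j})"
    using l by (auto simp: permutations_of_set_def)
  then show "l \<in> (\<lambda>m. m @ [j]) ` permutations_of_set (S - {j})"
    using k by blast
qed

text \<open>
  Taking the residue along \<open>u\<^sub>j = 0\<close>, for \<open>j\<close> the last letter of \<open>l\<close>, turns a linear
  relation on \<open>S\<close> into one on \<open>S - {j}\<close> in which the coefficient of \<open>l\<close> still occurs.
\<close>

lemma suffix_frac_independent:
  assumes "finite S" "(\<Sum>l\<in>permutations_of_set S. rconst (c l) * suffix_frac l) = 0"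
    and "l \<in> permutations_of_set S"
  shows "c l = 0"
  using assms
proof (induction "card S" arbitrary: S c l)
  case 0
  then have "S = {}"
    by auto
  then show ?case
    using 0 by simp
next
  case (Suc n)
  have "l \<noteq> []"
    using Suc.prems Suc.hyps(2) by (auto simp: permutations_of_set_def)
  then obtain k j where l: "l = k @ [j]"
    by (metis rev_exhaust)
  have j: "j \<in> S"
    using Suc.prems(3) by (auto simp: l permutations_of_set_def)
  let ?P = "permutations_of_set S" and ?Q = "permutations_of_set (S - {j})"
  have bij: "bij_betw (\<lambda>m. m @ [j]) ?Q {l \<in> ?P. last l = j}"
    using j by (rule permutations_of_set_snoc)
  \<comment> \<open>the residue of the linear relation, term by term\<close>
  have sub: "subst_to (kill j) (\<Sum>l\<in>?P. rconst (c l) * (uvar j * suffix_frac l))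
      (\<Sum>l\<in>?P. rconst (c l) * (if last l = j then suffix_frac (butlast l) else 0))"
    using j by (intro subst_to_sum subst_to_mult subst_to_rconst subst_to_kill_residue)
      (auto simp: permutations_of_set_def)
  have zero: "(\<Sum>l\<in>?P. rconst (c l) * (uvar j * suffix_frac l)) = 0"
    using arg_cong[OF Suc.prems(2), of "\<lambda>r. uvar j * r"]
    by (simp add: sum_distrib_left mult.left_commute)
  have "0 = (\<Sum>l\<in>?P. rconst (c l) * (if last l = j then suffix_frac (butlast l) else 0))"
    using sub unfolding zero by (rule subst_to_unique[OF subst_to_0])
  also have "\<dots> = (\<Sum>l\<in>{l \<in> ?P. last l = j}. rconst (c l) * suffix_frac (butlast l))"
    using Suc.prems(1) by (intro sum.mono_neutral_cong_right) auto
  also have "\<dots> = (\<Sum>m\<in>?Q. rconst (c (m @ [j])) * suffix_frac m)"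
    by (subst sum.reindex_bij_betw[OF bij, symmetric]) simp
  finally have "(\<Sum>m\<in>?Q. rconst (c (m @ [j])) * suffix_frac m) = 0"
    by simp
  moreover have "k \<in> ?Q"
    using Suc.prems(3) by (auto simp: l permutations_of_set_def)
  ultimately have "c (k @ [j]) = 0"
    using Suc.hyps(1)[of "S - {j}" "\<lambda>m. c (m @ [j])" k] Suc.hyps(2) Suc.prems(1) j by simp
  then show ?case
    using l by simp
qed

lemma zcoef_sum:
  "generic v \<Longrightarrow> zcoef v (\<Sum>i\<in>I. f i) S = (\<Sum>i\<in>I. zcoef v (f i) S)"
  by (induction I rule: infinite_finite_induct) (simp_all add: zcoef_0 zcoef_add)

lemma zcoef_uvar_inj:
  assumes A: "finite A" "A \<noteq> {}" and a: "a \<in> homog A" and 0: "zcoef uvar a A = 0"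
  shows "a = 0"
proof -
  let ?P = "permutations_of_set A"
  obtain c where c: "a = (\<Sum>l\<in>?P. zscale (c l) (zword l))"
    using a A by (auto simp: homog_eq_span_words intro: span_image_sum[of ?P a zword])
  have "zcoef uvar (zword l) A = suffix_frac l" if "l \<in> ?P" for l
    using that A zcoef_zword[of l] by (auto simp: permutations_of_set_def)
  then have "(\<Sum>l\<in>?P. rconst (c l) * suffix_frac l) = 0"
    using 0 by (simp add: c zcoef_sum zcoef_scale generic_uvar)
  then have "c l = 0" if "l \<in> ?P" for l
    using suffix_frac_independent[OF A(1)] that by blast
  then show ?thesis
    by (simp add: c)
qed

section \<open>Permutations and words\<close>

lemma suffix_frac_prod:
  "distinct l \<Longrightarrow>
    suffix_frac l = 1 / (\<Prod>k = 1..length l. \<Sum>j = 1..k. uvar (l ! (length l - j)))"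
proof (induction l)
  case (Cons x l)
  let ?n = "length l"
  have all: "(\<Sum>j = 1..Suc ?n. uvar ((x # l) ! (Suc ?n - j))) = sum uvar (set (x # l))"
  proof -
    have "(\<Sum>j = 1..Suc ?n. uvar ((x # l) ! (Suc ?n - j))) = (\<Sum>j<Suc ?n. uvar ((x # l) ! j))"
      by (rule sum.reindex_bij_witness[of _ "\<lambda>j. Suc ?n - j" "\<lambda>j. Suc ?n - j"]) auto
    also have "\<dots> = sum_list (map uvar (x # l))"
      by (simp only: sum_list_sum_nth atLeast0LessThan length_map length_Cons)
        (intro sum.cong HOL.refl, simp only: nth_map length_Cons lessThan_iff)
    also have "\<dots> = sum uvar (set (x # l))"
      using Cons.prems by (rule sum_list_distinct_conv_sum_set)
    finally show ?thesis .
  qed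
  have "(\<Prod>k = 1..?n. \<Sum>j = 1..k. uvar ((x # l) ! (Suc ?n - j))) =
      (\<Prod>k = 1..?n. \<Sum>j = 1..k. uvar (l ! (?n - j)))"
    by (intro prod.cong sum.cong HOL.refl) (auto simp: Suc_diff_le)
  then have "(\<Prod>k = 1..length (x # l). \<Sum>j = 1..k. uvar ((x # l) ! (length (x # l) - j))) =
      sum uvar (set (x # l)) * (\<Prod>k = 1..?n. \<Sum>j = 1..k. uvar (l ! (?n - j)))"
    by (simp only: length_Cons all prod.nat_ivl_Suc'[OF le_add1[of 1 ?n, unfolded plus_1_eq_Suc]])
  moreover have "suffix_frac l = 1 / (\<Prod>k = 1..?n. \<Sum>j = 1..k. uvar (l ! (?n - j)))"
    using Cons by simp
  ultimately show ?case
    by (simp only: suffix_frac.simps divide_divide_eq_left mult.commute)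
qed simp

lemma permutes_word:
  assumes "w permutes {1..n}"
  shows "map w [1..<n + 1] \<in> permutations_of_set {1..n}"
proof -
  have "set (map w [1..<n + 1]) = w ` {1..n}"
    by (auto simp: image_iff)
  also have "\<dots> = {1..n}"
    using assms by (rule permutes_image)
  finally show ?thesis
    using permutes_inj_on[OF assms] by (intro permutations_of_setI) (simp_all add: distinct_map)
qed

lemma word_permutes:
  assumes "l \<in> permutations_of_set {1..n}"
  obtains w where "w permutes {1..n}" "map w [1..<n + 1] = l"
proof -
  have l: "set l = {1..n}" "distinct l"
    using assms by (auto simp: permutations_of_set_def)
  then have len: "length l = n"
    using distinct_card by fastforce
  define w where "w = (\<lambda>j. if j \<in> {1..n} then l ! (j - 1) else j)"
  have map_w: "map w [1..<n + 1] = l"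
    by (rule nth_equalityI) (auto simp: w_def len simp del: upt_Suc)
  have "w ` {1..n} = set (map w [1..<n + 1])"
    by (auto simp: image_iff)
  then have img: "w ` {1..n} = {1..n}"
    by (simp only: map_w l)
  moreover have "inj_on w {1..n}"
    by (rule eq_card_imp_inj_on) (simp_all only: img finite_atLeastAtMost)
  ultimately have "w permutes {1..n}"
    by (intro bij_imp_permutes) (auto simp: bij_betw_def w_def)
  then show ?thesis
    using map_w that by blast
qed

lemma mirror_mirror:
  assumes "w permutes {1..n}"
  shows "mirror n (mirror n w) = w"
proof
  fix j show "mirror n (mirror n w) j = w j"
    using assms by (auto simp: mirror_def permutes_not_in)
qed

lemma mirror_permutes:
  assumes "w permutes {1..n}"
  shows "mirror n w permutes {1..n}"
proof -
  have "mirror n id permutes {1..n}"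
    by (rule bij_imp_permutes, rule bij_betwI[where g = "mirror n id"]) (auto simp: mirror_def)
  moreover have "mirror n w = w \<circ> mirror n id"
    using assms by (auto simp: mirror_def fun_eq_iff permutes_not_in)
  ultimately show ?thesis
    using assms permutes_compose by metis
qed

lemma fperm_mirror:
  assumes "w permutes {1..n}"
  shows "fperm n (mirror n w) = suffix_frac (map w [1..<n + 1])"
proof -
  let ?l = "map w [1..<n + 1]"
  have "distinct ?l" "length ?l = n"
    using permutes_word[OF assms] by (auto simp: permutations_of_set_def)
  moreover have "uvar (?l ! (n - j)) = uvar (mirror n w j)" if "j \<in> {1..n}" for j
    using that by (simp add: mirror_def Suc_diff_le del: upt_Suc)
  then have "(\<Prod>k = 1..n. \<Sum>j = 1..k. uvar (?l ! (n - j))) =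
      (\<Prod>k = 1..n. \<Sum>j = 1..k. uvar (mirror n w j))"
    by (intro prod.cong sum.cong HOL.refl) auto
  ultimately show ?thesis
    by (simp add: fperm_def suffix_frac_prod del: upt_Suc)
qed

lemma fperm_set:
  "{fperm n \<sigma> | \<sigma>. \<sigma> permutes {1..n}} = suffix_frac ` permutations_of_set {1..n}"
proof (intro subset_antisym subsetI)
  fix r assume "r \<in> {fperm n \<sigma> | \<sigma>. \<sigma> permutes {1..n}}"
  then obtain \<sigma> where \<sigma>: "\<sigma> permutes {1..n}" "r = fperm n \<sigma>"
    by blast
  then have "r = fperm n (mirror n (mirror n \<sigma>))"
    by (simp add: mirror_mirror)
  then show "r \<in> suffix_frac ` permutations_of_set {1..n}"
    using fperm_mirror permutes_word mirror_permutes \<sigma>(1) by blast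
next
  fix r assume "r \<in> suffix_frac ` permutations_of_set {1..n}"
  then obtain l where l: "l \<in> permutations_of_set {1..n}" "r = suffix_frac l"
    by blast
  obtain w where w: "w permutes {1..n}" "map w [1..<n + 1] = l"
    using word_permutes[OF l(1)] .
  have "r = fperm n (mirror n w)"
    by (simp only: fperm_mirror[OF w(1)] w(2) l(2))
  then show "r \<in> {fperm n \<sigma> | \<sigma>. \<sigma> permutes {1..n}}"
    using mirror_permutes[OF w(1)] by blast
qed

lemma Zinb_eq: "Zinb n = homog {1..n}"
  by (simp add: Zinb_def homog_def)

text \<open>
  The comparison map, given at once on all Zinbiel elements rather than on the basis of words:
  this is what makes the compatibility with compositions independent of any shuffle formula.
\<close>

definition mould_of :: "nat \<Rightarrow> nat zinbiel \<Rightarrow> ratfun" where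
  "mould_of n a = zcoef uvar a {1..n}"

lemma mould_of_add: "mould_of n (a + b) = mould_of n a + mould_of n b"
  by (simp add: mould_of_def zcoef_add generic_uvar)

lemma mould_of_scale: "mould_of n (zscale r a) = rscale r (mould_of n a)"
  by (simp add: mould_of_def zcoef_scale generic_uvar rscale_def)

lemma mould_of_0: "mould_of n 0 = 0"
  by (simp add: mould_of_def zcoef_0 generic_uvar)

lemma mould_of_zword:
  assumes "n \<ge> 1" "l \<in> permutations_of_set {1..n}"
  shows "mould_of n (zword l) = suffix_frac l"
proof -
  have l: "set l = {1..n}" "distinct l"
    using assms(2) by (auto simp: permutations_of_set_def)
  then have "l \<noteq> []"
    using assms(1) by auto
  from zcoef_zword[OF l(2) this] show ?thesis
    by (simp only: mould_of_def l(1))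
qed

lemma mould_of_eperm:
  assumes "n \<ge> 1" "w permutes {1..n}"
  shows "mould_of n (eperm n w) = fperm n (mirror n w)"
  unfolding eperm_def fperm_mirror[OF assms(2)]
  using assms(1) permutes_word[OF assms(2)] by (rule mould_of_zword)

lemma Zinb_words: "n \<ge> 1 \<Longrightarrow> Zinb n = zb_span (words {1..n})"
  by (simp add: Zinb_eq homog_eq_span_words)

lemma mould_of_image:
  assumes "n \<ge> 1"
  shows "mould_of n ` Zinb n = Zspan n"
proof (intro subset_antisym subsetI)
  fix r assume "r \<in> mould_of n ` Zinb n"
  then obtain a where r: "r = mould_of n a" and "a \<in> zb_span (words {1..n})"
    using assms by (auto simp: Zinb_words)
  from this(2) show "r \<in> Zspan n"
    unfolding r Zspan_def fperm_set
  proof (induction rule: zb.span_induct_alt)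
    case base
    show ?case by (simp add: mould_of_0 rf.span_zero)
  next
    case (step c x a)
    then have "mould_of n x \<in> suffix_frac ` permutations_of_set {1..n}"
      using assms by (auto simp: mould_of_zword)
    then show ?case
      using step by (simp add: mould_of_add mould_of_scale rf.span_add rf.span_scale rf.span_base)
  qed
next
  fix r assume "r \<in> Zspan n"
  then show "r \<in> mould_of n ` Zinb n"
    unfolding Zspan_def fperm_set Zinb_words[OF assms]
  proof (induction rule: rf.span_induct_alt)
    case base
    show ?case by (metis imageI mould_of_0 zb.span_zero)
  next
    case (step c x r)
    then obtain l a where l: "l \<in> permutations_of_set {1..n}" "x = suffix_frac l"
      and a: "a \<in> zb_span (words {1..n})" "r = mould_of n a"
      by auto
    have "rscale c x + r = mould_of n (zscale c (zword l) + a)"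
      using l a assms by (simp add: mould_of_add mould_of_scale mould_of_zword)
    moreover have "zscale c (zword l) + a \<in> zb_span (words {1..n})"
      by (intro zb.span_add a(1) zb.span_scale zb.span_base imageI l(1))
    ultimately show ?case by blast
  qed
qed

lemma mould_of_inj:
  assumes "n \<ge> 1"
  shows "inj_on (mould_of n) (Zinb n)"
proof (rule inj_onI)
  fix a b assume ab: "a \<in> Zinb n" "b \<in> Zinb n" "mould_of n a = mould_of n b"
  let ?d = "a + zscale (- 1) b"
  have "?d \<in> homog {1..n}"
    by (intro homog_add homog_scale ab(1,2)[unfolded Zinb_eq])
  moreover have "mould_of n ?d = 0"
    by (simp only: mould_of_add mould_of_scale ab(3)) (simp add: rf.scale_minus_left)
  then have "zcoef uvar ?d {1..n} = 0"
    by (simp only: mould_of_def)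
  ultimately have "?d = 0"
    using assms by (intro zcoef_uvar_inj[of "{1..n}"]) auto
  then show "a = b"
    by (simp add: zb.scale_minus_left)
qed

section \<open>Compositions\<close>

lemma zcoef_relabel:
  fixes b :: "nat zinbiel"
  assumes "i \<ge> 1" and b: "b \<in> homog {1..n}"
  defines "b' \<equiv> zsubst (\<lambda>k. zgen (k + i - 1)) b"
  shows "b' \<in> homog {i..i + n - 1}"
    and "zcoef uvar b' {i..i + n - 1} = rsubst (\<lambda>j. uvar (j + i - 1)) (zcoef uvar b {1..n})"
proof -
  let ?T = "\<lambda>k. {k + i - 1}" and ?\<tau> = "\<lambda>j. uvar (j + i - 1)"
  have disj: "?T x \<inter> ?T y = {}" if "x \<noteq> y" for x y
    using that assms(1) by auto
  have "{i..i + n - 1} \<subseteq> \<Union> (?T ` {1..n})"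
  proof
    fix x assume "x \<in> {i..i + n - 1}"
    then have "x \<in> ?T (x - i + 1)" "x - i + 1 \<in> {1..n}"
      using assms(1) by auto
    then show "x \<in> \<Union> (?T ` {1..n})"
      by blast
  qed
  then have union: "\<Union> (?T ` {1..n}) = {i..i + n - 1}"
    using assms(1) by auto
  show "b' \<in> homog {i..i + n - 1}"
    unfolding b'_def union[symmetric]
    by (rule homog_zsubst[OF _ disj b]) (auto intro: homog_mono zmono.gen)
  have nz: "uvar k \<noteq> 0" for k
    using genericD[OF generic_uvar, of "{k}"] by simp
  have "generic (\<lambda>x. sum uvar (?T x))"
    by (rule generic_blocks[OF generic_uvar _ _ disj]) auto
  then have gen: "generic ?\<tau>"
    by simp
  have "zcoef uvar b' (\<Union> (?T ` {1..n})) =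
      (\<Prod>x\<in>{1..n}. sum uvar (?T x) * zcoef uvar (zgen (x + i - 1)) (?T x)) *
      zcoef (\<lambda>x. sum uvar (?T x)) b {1..n}"
    unfolding b'_def
    by (rule zcoef_zsubst(2)[OF generic_uvar _ _ disj]) (auto simp: zcoef_gen generic_uvar)
  then have "zcoef uvar b' {i..i + n - 1} = zcoef ?\<tau> b {1..n}"
    unfolding union by (simp add: zcoef_gen generic_uvar nz)
  also have "\<dots> = rsubst ?\<tau> (zcoef uvar b {1..n})"
    by (rule rsubst_eq[OF subst_to_zcoef[OF gen], symmetric])
  finally show "zcoef uvar b' {i..i + n - 1} = rsubst ?\<tau> (zcoef uvar b {1..n})" .
qed

text \<open>
  The blocks are \<open>{i..i + n - 1}\<close> for \<open>x\<^sub>i\<close> and singletons otherwise. A singleton contributes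
  the factor \<open>u\<^sub>j \<cdot> 1 / u\<^sub>j = 1\<close> and the block of \<open>x\<^sub>i\<close> contributes \<open>s\<close> times the renamed
  second argument, while the block weights are the substitution made in the first argument.
\<close>

lemma mould_of_comp:
  assumes m: "m \<ge> 1" and n: "n \<ge> 1" and i: "i \<in> {1..m}"
    and a: "a \<in> Zinb m" and b: "b \<in> Zinb n"
  shows "zinb_comp n i a b \<in> Zinb (m + n - 1)"
    and "mould_of (m + n - 1) (zinb_comp n i a b) = mould_comp n i (mould_of m a) (mould_of n b)"
proof -
  let ?I = "{i..i + n - 1}"
  define b' where "b' = zsubst (\<lambda>k. zgen (k + i - 1)) b"
  define T where "T = (\<lambda>j. if j < i then {j} else if j = i then ?I else {j + n - 1})"
  define \<theta> where "\<theta> = (\<lambda>j. if j < i then zgen j else if j = i then b' else zgen (j + n - 1))"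
  define s where "s = sum uvar ?I"
  define v where "v = (\<lambda>j. if j < i then uvar j else if j = i then s else uvar (j + n - 1))"
  have i1: "i \<ge> 1"
    using i by simp
  have b': "b' \<in> homog ?I"
    unfolding b'_def using b by (intro zcoef_relabel(1) i1) (simp add: Zinb_eq)
  have comp: "zinb_comp n i a b = zsubst \<theta> a"
    unfolding zinb_comp_def \<theta>_def b'_def ..
  have T: "finite (T x)" "T x \<noteq> {}" for x
    using n by (auto simp: T_def)
  have disj: "T x \<inter> T y = {}" if "x \<noteq> y" for x y
    using that n by (auto simp: T_def)
  have \<theta>: "\<theta> x \<in> homog (T x)" for x
    using b' by (auto simp: \<theta>_def T_def intro: homog_mono zmono.gen)
  have union: "\<Union> (T ` {1..m}) = {1..m + n - 1}"
  proof (intro subset_antisym subsetI)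
    fix x assume "x \<in> \<Union> (T ` {1..m})"
    then show "x \<in> {1..m + n - 1}"
      using i n by (auto simp: T_def split: if_splits)
  next
    fix x assume x: "x \<in> {1..m + n - 1}"
    consider "x < i" | "x \<in> ?I" | "x > i + n - 1"
      using n by force
    then have "\<exists>j\<in>{1..m}. x \<in> T j"
    proof cases
      case 1
      then show ?thesis
        using x i by (intro bexI[of _ x]) (auto simp: T_def)
    next
      case 2
      then show ?thesis
        using i by (intro bexI[of _ i]) (auto simp: T_def)
    next
      case 3
      then show ?thesis
        using x i n by (intro bexI[of _ "x - n + 1"]) (auto simp: T_def)
    qed
    then show "x \<in> \<Union> (T ` {1..m})"
      by blast
  qed
  show "zinb_comp n i a b \<in> Zinb (m + n - 1)"
    unfolding comp Zinb_eq union[symmetric]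
    by (rule homog_zsubst[OF \<theta> disj a[unfolded Zinb_eq]])
  have v: "(\<lambda>x. sum uvar (T x)) = v"
    by (auto simp: v_def T_def s_def)
  have gen: "generic v"
    unfolding v[symmetric] by (rule generic_blocks[OF generic_uvar T disj])
  have nz: "uvar k \<noteq> 0" for k
    using genericD[OF generic_uvar, of "{k}"] by simp
  let ?c = "\<lambda>x. v x * zcoef uvar (\<theta> x) (T x)"
  have "zcoef uvar (zsubst \<theta> a) (\<Union> (T ` {1..m})) =
      (\<Prod>x\<in>{1..m}. sum uvar (T x) * zcoef uvar (\<theta> x) (T x)) *
      zcoef (\<lambda>x. sum uvar (T x)) a {1..m}"
    by (rule zcoef_zsubst(2)[OF generic_uvar T disj])
      (auto intro: zcoef_homog[OF generic_uvar \<theta>])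
  then have "mould_of (m + n - 1) (zinb_comp n i a b) =
      (\<Prod>x\<in>{1..m}. ?c x) * zcoef v a {1..m}"
    unfolding mould_of_def comp v union using fun_cong[OF v] by simp
  also have "(\<Prod>x\<in>{1..m}. ?c x) = (\<Prod>x\<in>{1..m}. if x = i then s * zcoef uvar b' ?I else 1)"
    by (intro prod.cong HOL.refl) (simp add: v_def \<theta>_def T_def zcoef_gen generic_uvar nz)
  also have "\<dots> = s * zcoef uvar b' ?I"
    using i by simp
  also have "zcoef uvar b' ?I = rsubst (\<lambda>j. uvar (j + i - 1)) (mould_of n b)"
    unfolding b'_def mould_of_def using b by (intro zcoef_relabel(2) i1) (simp add: Zinb_eq)
  also have "zcoef v a {1..m} = rsubst v (mould_of m a)"
    unfolding mould_of_def by (rule rsubst_eq[OF subst_to_zcoef[OF gen], symmetric])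
  finally show "mould_of (m + n - 1) (zinb_comp n i a b) =
      mould_comp n i (mould_of m a) (mould_of n b)"
    unfolding mould_comp_def Let_def v_def s_def by (simp only: mult_ac)
qed

section \<open>The suboperad\<close>

lemma MouldI: "q \<noteq> 0 \<Longrightarrow> pvars p \<subseteq> {1..n} \<Longrightarrow> pvars q \<subseteq> {1..n} \<Longrightarrow> Fract p q \<in> Mould n"
  by (auto simp: Mould_def)

lemma MouldE:
  assumes "r \<in> Mould n"
  obtains p q where "r = Fract p q" "q \<noteq> 0" "pvars p \<subseteq> {1..n}" "pvars q \<subseteq> {1..n}"
  using assms by (auto simp: Mould_def)

lemma pvars_add: "pvars (p + q) \<subseteq> pvars p \<union> pvars q"
  using Poly_Mapping.keys_add[of p q] by (auto simp: pvars_def)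

lemma pvars_mult: "pvars (p * q) \<subseteq> pvars p \<union> pvars q"
proof
  fix x assume "x \<in> pvars (p * q)"
  then obtain m where "m \<in> Poly_Mapping.keys (p * q)" "x \<in> Poly_Mapping.keys m"
    by (auto simp: pvars_def)
  then obtain a b where "a \<in> Poly_Mapping.keys p" "b \<in> Poly_Mapping.keys q"
      "x \<in> Poly_Mapping.keys (a + b)"
    using keys_mult[of p q] by blast
  then show "x \<in> pvars p \<union> pvars q"
    using Poly_Mapping.keys_add[of a b] by (auto simp: pvars_def)
qed

lemma pvars_const: "pvars (Poly_Mapping.single 0 c) = {}"
  by (simp add: pvars_def)

lemma pvars_1: "pvars 1 = {}"
  using pvars_const[of 1] by simp

lemma Mould_rconst: "rconst c \<in> Mould n"
  unfolding rconst_def by (rule MouldI) (simp_all add: pvars_const pvars_1)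

lemma Mould_uvar: "j \<in> {1..n} \<Longrightarrow> uvar j \<in> Mould n"
  unfolding uvar_def by (rule MouldI) (simp_all add: pvars_1 pvars_def)

lemma Mould_add:
  assumes "r \<in> Mould n" "r' \<in> Mould n"
  shows "r + r' \<in> Mould n"
proof -
  obtain p q where 1: "r = Fract p q" "q \<noteq> 0" "pvars p \<subseteq> {1..n}" "pvars q \<subseteq> {1..n}"
    using assms(1) by (rule MouldE)
  obtain p' q' where 2: "r' = Fract p' q'" "q' \<noteq> 0" "pvars p' \<subseteq> {1..n}" "pvars q' \<subseteq> {1..n}"
    using assms(2) by (rule MouldE)
  have "pvars (p * q') \<subseteq> {1..n}" "pvars (p' * q) \<subseteq> {1..n}" "pvars (q * q') \<subseteq> {1..n}"
    using 1 2 pvars_mult by (meson Un_least subset_trans)+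
  moreover from this have "pvars (p * q' + p' * q) \<subseteq> {1..n}"
    using pvars_add by (meson Un_least subset_trans)
  ultimately show ?thesis
    using 1 2 by (simp add: MouldI)
qed

lemma Mould_mult:
  assumes "r \<in> Mould n" "r' \<in> Mould n"
  shows "r * r' \<in> Mould n"
proof -
  obtain p q where 1: "r = Fract p q" "q \<noteq> 0" "pvars p \<subseteq> {1..n}" "pvars q \<subseteq> {1..n}"
    using assms(1) by (rule MouldE)
  obtain p' q' where 2: "r' = Fract p' q'" "q' \<noteq> 0" "pvars p' \<subseteq> {1..n}" "pvars q' \<subseteq> {1..n}"
    using assms(2) by (rule MouldE)
  have "pvars (p * p') \<subseteq> {1..n}" "pvars (q * q') \<subseteq> {1..n}"
    using 1 2 pvars_mult by (meson Un_least subset_trans)+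
  then show ?thesis
    using 1 2 by (simp add: MouldI)
qed

lemma Mould_inverse:
  assumes "r \<in> Mould n"
  shows "inverse r \<in> Mould n"
proof (cases "r = 0")
  case True
  then show ?thesis using assms by simp
next
  case False
  obtain p q where pq: "r = Fract p q" "q \<noteq> 0" "pvars p \<subseteq> {1..n}" "pvars q \<subseteq> {1..n}"
    using assms by (rule MouldE)
  then have "p \<noteq> 0"
    using False by (auto simp: Zero_fract_def eq_fract)
  then show ?thesis
    using pq by (simp add: MouldI)
qed

lemma Mould_sum: "(\<And>x. x \<in> A \<Longrightarrow> f x \<in> Mould n) \<Longrightarrow> sum f A \<in> Mould n"
  using Mould_rconst[of 0] by (induction A rule: infinite_finite_induct) (auto intro: Mould_add)

lemma Mould_prod: "(\<And>x. x \<in> A \<Longrightarrow> f x \<in> Mould n) \<Longrightarrow> prod f A \<in> Mould n"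
  using Mould_rconst[of 1] by (induction A rule: infinite_finite_induct) (auto intro: Mould_mult)

lemma fperm_Mould:
  assumes "\<sigma> permutes {1..n}"
  shows "fperm n \<sigma> \<in> Mould n"
proof -
  have "\<sigma> j \<in> {1..n}" if "j \<in> {1..n}" for j
    using that permutes_in_image[OF assms] by simp
  then have "(\<Prod>k = 1..n. \<Sum>j = 1..k. uvar (\<sigma> j)) \<in> Mould n"
    by (intro Mould_prod Mould_sum Mould_uvar) auto
  then show ?thesis
    by (simp add: fperm_def Mould_inverse flip: inverse_eq_divide)
qed

lemma Zspan_Mould: "Zspan n \<subseteq> Mould n"
proof
  fix r assume "r \<in> Zspan n"
  then show "r \<in> Mould n"
    unfolding Zspan_def
  proof (induction rule: rf.span_induct_alt)
    case base
    show ?case using Mould_rconst[of 0] by simp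
  next
    case (step c x y)
    then show ?case
      by (auto simp: rscale_def intro!: Mould_add Mould_mult Mould_rconst fperm_Mould)
  qed
qed

lemma zinb_unit_Zinb: "zinb_unit \<in> Zinb 1"
  by (simp add: zinb_unit_def Zinb_eq homog_mono zmono.gen)

lemma mould_of_unit: "mould_of 1 zinb_unit = mould_unit"
  by (simp add: mould_of_def zinb_unit_def mould_unit_def zcoef_gen generic_uvar)

lemma mirror_maps_mould_of: "mirror_maps mould_of"
  by (simp add: mirror_maps_def mould_of_add mould_of_scale mould_of_eperm)

text \<open>
  A comparison map is prescribed on the words, and these span.
\<close>

lemma mirror_maps_unique:
  assumes \<phi>: "mirror_maps \<phi>" and n: "n \<ge> 1" and a: "a \<in> Zinb n"
  shows "\<phi> n a = mould_of n a"
proof -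
  have add: "\<phi> n (x + y) = \<phi> n x + \<phi> n y" if "x \<in> Zinb n" "y \<in> Zinb n" for x y
    using \<phi> n that by (simp add: mirror_maps_def)
  have scale: "\<phi> n (zscale r x) = rscale r (\<phi> n x)" if "x \<in> Zinb n" for r x
    using \<phi> n that by (simp add: mirror_maps_def)
  have perm: "\<phi> n (eperm n w) = fperm n (mirror n w)" if "w permutes {1..n}" for w
    using \<phi> n that by (simp add: mirror_maps_def)
  have words: "\<phi> n (zword l) = mould_of n (zword l)" if l: "l \<in> permutations_of_set {1..n}" for l
  proof -
    obtain w where w: "w permutes {1..n}" "map w [1..<n + 1] = l"
      using word_permutes[OF l] .
    then have "eperm n w = zword l"
      by (simp only: eperm_def)
    then show ?thesis
      using perm[OF w(1)] mould_of_eperm[OF n w(1)] by simp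
  qed
  have "\<phi> n a = mould_of n a \<and> a \<in> Zinb n"
    using a unfolding Zinb_words[OF n]
  proof (induction rule: zb.span_induct_alt)
    case base
    have "\<phi> n (zscale 0 0) = rscale 0 (\<phi> n 0)"
      by (rule scale) (simp add: Zinb_eq homog_0)
    then show ?case
      by (simp add: mould_of_0 zb.span_zero)
  next
    case (step c x y)
    then have mem: "x \<in> Zinb n" "zscale c x \<in> Zinb n" "y \<in> Zinb n"
      unfolding Zinb_words[OF n] by (auto intro: zb.span_base zb.span_scale)
    have "\<phi> n x = mould_of n x"
      using step(1) words by blast
    then have "\<phi> n (zscale c x + y) = mould_of n (zscale c x + y)"
      using step by (simp add: add[OF mem(2,3)] scale[OF mem(1)] mould_of_add mould_of_scale)
    moreover have "zscale c x + y \<in> zb_span (words {1..n})"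
      using mem(2,3) unfolding Zinb_words[OF n] by (rule zb.span_add)
    ultimately show ?case ..
  qed
  then show ?thesis ..
qed

text \<open>
  Stability under composition is inherited from \<open>Zinb\<close> through the comparison maps.
\<close>

lemma suboperad_Zspan: "suboperad_Mould Zspan"
  unfolding suboperad_Mould_def
proof (intro conjI allI impI ballI)
  fix n
  show "rf_subspace (Zspan n)"
    unfolding Zspan_def by (rule rf.subspace_span)
  show "Zspan n \<subseteq> Mould n"
    by (rule Zspan_Mould)
next
  show "mould_unit \<in> Zspan 1"
    using mould_of_image[of 1] mould_of_unit zinb_unit_Zinb by (metis imageI order_refl)
next
  fix m n i f g
  assume mn: "(1::nat) \<le> m" "(1::nat) \<le> n" and i: "i \<in> {1..m}"
    and fg: "f \<in> Zspan m" "g \<in> Zspan n"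
  obtain a b where ab: "a \<in> Zinb m" "b \<in> Zinb n" "f = mould_of m a" "g = mould_of n b"
    using fg mould_of_image mn by blast
  have "1 \<le> m + n - 1"
    using mn by simp
  then show "mould_comp n i f g \<in> Zspan (m + n - 1)"
    using mould_of_comp[OF mn i ab(1,2)] mould_of_image ab(3,4) by (metis imageI)
qed

theorem mainTheorem1:
  shows "suboperad_Mould Zspan \<and>
    (\<exists>\<phi>. mirror_maps \<phi>) \<and>
    (\<forall>\<phi>. mirror_maps \<phi> \<longrightarrow> operad_iso_Zinb Zspan \<phi>)"
proof (intro conjI allI impI)
  show "suboperad_Mould Zspan"
    by (rule suboperad_Zspan)
  show "\<exists>\<phi>. mirror_maps \<phi>"
    using mirror_maps_mould_of by blast
  fix \<phi> assume \<phi>: "mirror_maps \<phi>"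
  note eq = mirror_maps_unique[OF \<phi>]
  show "operad_iso_Zinb Zspan \<phi>"
    unfolding operad_iso_Zinb_def
  proof (intro conjI allI impI ballI)
    fix n :: nat assume n: "1 \<le> n"
    have "bij_betw (mould_of n) (Zinb n) (Zspan n)"
      using mould_of_inj[OF n] mould_of_image[OF n] by (simp add: bij_betw_def)
    then show "bij_betw (\<phi> n) (Zinb n) (Zspan n)"
      using bij_betw_cong eq[OF n] by metis
    show "\<phi> n (a + b) = \<phi> n a + \<phi> n b" if "a \<in> Zinb n" "b \<in> Zinb n" for a b
      using \<phi> n that by (simp add: mirror_maps_def)
    show "\<phi> n (zscale r a) = rscale r (\<phi> n a)" if "a \<in> Zinb n" for r a
      using \<phi> n that by (simp add: mirror_maps_def)
  next
    show "\<phi> 1 zinb_unit = mould_unit"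
      using eq[of 1, OF order_refl zinb_unit_Zinb] mould_of_unit by simp
  next
    fix m n i a b
    assume mn: "(1::nat) \<le> m" "(1::nat) \<le> n" and i: "i \<in> {1..m}"
      and ab: "a \<in> Zinb m" "b \<in> Zinb n"
    have "1 \<le> m + n - 1"
      using mn by simp
    then show "\<phi> (m + n - 1) (zinb_comp n i a b) = mould_comp n i (\<phi> m a) (\<phi> n b)"
      using mould_of_comp[OF mn i ab] eq[OF mn(1) ab(1)] eq[OF mn(2) ab(2)] eq by simp
  qed
qed

end
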